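(* Let $P=\{p_k\}_{k\ge1}$ be a system of Beurling generalized primes with associated generalized integers $\{n_k\}_{k\ge1}$, counting function $N(x)=\sum_{n_k<x}1$ and Chebyshev function $\psi(x)=\sum_{n_k<x}\Lambda(n_k)$. Suppose there is a constant $a>0$ such that $$\int_{1}^{\infty}\left|\frac{N(x)-ax}{x}\right|\frac{\mathrm{d}x}{x}<\infty$$ and $$N(x)=ax+o\!\left(\frac{x}{\log x}\right),\qquad x\to\infty .$$ Then $$0<\liminf_{x\to\infty}\frac{\psi(x)}{x}\quad\text{and}\quad\limsup_{x\to\infty}\frac{\psi(x)}{x}<\infty .$$
   Context: A system of Beurling generalized primes is a non-decreasing sequence $P=\{p_k\}_{k\ge1}$ of real numbers with $p_1>1$ and $p_k\to\infty$. The associated generalized integers $\{n_k\}_{k\ge1}$ are all finite products $p_{k_1}^{\alpha_1}\cdots p_{k_m}^{\alpha_m}$ (with $\alpha_j\geq 0$ integers), arranged in non-decreasing order and counted with multiplicity (i.e. according to the number of distinct ways of writing them as such products, distinct indices counting as distinct primes even if equal as real numbers). The generalized von Mangoldt function $\Lambda$ is defined so that $\psi(x)=\sum_{n_k<x}\Lambda(n_k)=\sum_{(k,j):\,p_k^j<x,\ j\ge1}\log p_k$. *)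

theory Defs
  imports "HOL-Analysis.Analysis" "HOL-Library.Landau_Symbols" "HOL-Library.Liminf_Limsup"
begin

definition beurling_primes :: "(nat \<Rightarrow> real) \<Rightarrow> bool" where
  "beurling_primes p \<longleftrightarrow> mono p \<and> p 0 > 1 \<and> filterlim p at_top sequentially"

text \<open>Generalized integers counted with multiplicity: they correspond to finitely
  supported exponent vectors alpha, the integer being the product of p k ^ alpha k.\<close>
definition gen_int :: "(nat \<Rightarrow> real) \<Rightarrow> (nat \<Rightarrow> nat) \<Rightarrow> real" where
  "gen_int p \<alpha> = (\<Prod>k\<in>{k. \<alpha> k \<noteq> 0}. p k ^ \<alpha> k)"

definition beurling_N :: "(nat \<Rightarrow> real) \<Rightarrow> real \<Rightarrow> real" where
  "beurling_N p x = real (card {\<alpha>::nat \<Rightarrow> nat. finite {k. \<alpha> k \<noteq> 0} \<and> gen_int p \<alpha> < x})"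

definition beurling_psi :: "(nat \<Rightarrow> real) \<Rightarrow> real \<Rightarrow> real" where
  "beurling_psi p x = (\<Sum>(k, j)\<in>{(k, j). j \<ge> 1 \<and> p k ^ j < x}. ln (p k))"

end

theory Submission
  imports Defs
begin

text \<open>In the variable \<open>u = log x\<close> put \<open>F u = N(e^u) e^(-u) = a + E u\<close>, so that \<open>E\<close> is in
  \<open>L^1\<close> and \<open>u E u\<close> is bounded, and let \<open>\<mu>\<close> be the measure with mass \<open>\<Lambda>(n)/n\<close> at \<open>log n\<close>.
  The identity \<open>log \<cdot> dN = dN * d\<psi>\<close> says that \<open>F * \<mu> = a u + O(1)\<close>, whence
  \<open>a \<mu>(-\<infinity>,u) = a u + O(1) - (E * \<mu>)(u)\<close>.  Integrate this against the derivative of the kernel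
  \<open>k v = exp (-b |v|)\<close>.  Since \<open>|k'| = b k\<close>, the error term becomes at most
  \<open>O(1) + b \<integral> |E z| (k * \<mu>)(y - z) dz\<close>, which for small \<open>b\<close> is absorbed by \<open>a (k * \<mu>)(y)\<close>.
  Hence \<open>k * \<mu>\<close> is bounded, and as the main term is of size \<open>a / b\<close>, it is also bounded away from 0.
  Chebyshev's bounds for \<open>\<psi>\<close> follow by comparing \<open>k\<close> with \<open>exp (-v)\<close> on the half-line.\<close>

section \<open>The two-sided exponential kernel\<close>

definition lap :: "real \<Rightarrow> real \<Rightarrow> real" where
  "lap b v = exp (- b * \<bar>v\<bar>)"

lemma lap_measurable [measurable]: "lap b \<in> borel_measurable borel"
  unfolding lap_def by measurable

lemma lap_nonneg [simp]: "lap b v \<ge> 0"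
  and lap_minus [simp]: "lap b (- v) = lap b v"
  by (simp_all add: lap_def)

text \<open>Away from its peak the kernel is its own derivative up to the factor \<open>b\<close>
  and a sign, so its integral over a half-line that does not cross the peak is again a value of the
  kernel.\<close>

lemma nn_integral_lap_above:
  assumes "b > 0" "y \<le> x"
  shows "(\<integral>\<^sup>+u. ennreal (b * lap b (y - u)) * indicator {x..} u \<partial>lborel) = ennreal (lap b (y - x))"
proof -
  have "(\<integral>\<^sup>+u. ennreal (b * lap b (y - u)) * indicator {x..} u \<partial>lborel)
      = (\<integral>\<^sup>+u. ennreal (b * exp (- b * (u - y))) * indicator {x..} u \<partial>lborel)"
    using assms by (intro nn_integral_cong) (auto simp: lap_def split: split_indicator)
  also have "\<dots> = ennreal (0 - (- exp (- b * (x - y))))"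
  proof (rule nn_integral_FTC_atLeast)
    show "((\<lambda>u. - exp (- b * (u - y))) \<longlongrightarrow> 0) at_top"
    proof -
      have "filterlim (\<lambda>u. - b * (u - y)) at_bot at_top"
      proof -
        have "filterlim (\<lambda>u. - y + u) at_top at_top"
          by (rule filterlim_tendsto_add_at_top[OF tendsto_const filterlim_ident])
        then have "filterlim (\<lambda>u. b * (- y + u)) at_top at_top"
          by (rule filterlim_tendsto_pos_mult_at_top[OF tendsto_const \<open>b > 0\<close>])
        then show ?thesis
          by (simp add: filterlim_uminus_at_bot algebra_simps)
      qed
      then have "((\<lambda>u. exp (- b * (u - y))) \<longlongrightarrow> 0) at_top"
        by (rule filterlim_compose[OF exp_at_bot])
      then show ?thesis
        by (auto intro: tendsto_eq_intros)
    qed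
  qed (use assms in \<open>auto intro!: derivative_eq_intros\<close>)
  finally show ?thesis
    using assms by (simp add: lap_def)
qed

lemma nn_integral_lap_between:
  assumes "b > 0" "x \<le> y"
  shows "(\<integral>\<^sup>+u. ennreal (b * lap b (y - u)) * indicator {x..y} u \<partial>lborel)
      = ennreal (1 - lap b (y - x))"
proof -
  have "(\<integral>\<^sup>+u. ennreal (b * lap b (y - u)) * indicator {x..y} u \<partial>lborel)
      = (\<integral>\<^sup>+u. ennreal (b * exp (- b * (y - u))) * indicator {x..y} u \<partial>lborel)"
    using assms by (intro nn_integral_cong) (auto simp: lap_def split: split_indicator)
  also have "\<dots> = ennreal (exp (- b * (y - y)) - exp (- b * (y - x)))"
    by (rule nn_integral_FTC_Icc[where F="\<lambda>u. exp (- b * (y - u))"])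
       (use assms in \<open>auto intro!: derivative_eq_intros\<close>)
  finally show ?thesis
    using assms by (simp add: lap_def)
qed

lemma nn_integral_lap:
  assumes "b > 0"
  shows "(\<integral>\<^sup>+u. ennreal (b * lap b (y - u)) \<partial>lborel) = 2"
proof -
  let ?f = "\<lambda>u. ennreal (b * lap b (y - u))"
  have above: "(\<integral>\<^sup>+u. ?f u * indicator {y..} u \<partial>lborel) = 1"
    using nn_integral_lap_above[OF assms order_refl] by (simp add: lap_def)
  \<comment> \<open>Reflection about the peak \<open>y\<close> exchanges the two half-lines.\<close>
  have "(\<integral>\<^sup>+u. ?f u * indicator {..y} u \<partial>lborel)
      = ennreal \<bar>-1\<bar> * (\<integral>\<^sup>+u. ?f (2 * y + -1 * u) * indicator {..y} (2 * y + -1 * u) \<partial>lborel)"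
    by (rule nn_integral_real_affine) auto
  also have "\<dots> = (\<integral>\<^sup>+u. ?f u * indicator {y..} u \<partial>lborel)"
    by (auto intro!: nn_integral_cong simp: lap_def split: split_indicator)
  finally have below: "(\<integral>\<^sup>+u. ?f u * indicator {..y} u \<partial>lborel) = 1"
    using above by simp
  have "(\<integral>\<^sup>+u. ?f u \<partial>lborel) = (\<integral>\<^sup>+u. ?f u * indicator {y..} u + ?f u * indicator {..y} u \<partial>lborel)"
    using AE_lborel_singleton[of y] by (intro nn_integral_cong_AE, eventually_elim) (auto split: split_indicator)
  also have "\<dots> = 2"
    by (subst nn_integral_add) (auto simp: above below)
  finally show ?thesis .
qed

text \<open>The case of a unit mass at \<open>x\<close>. As a function of \<open>u\<close> the
  kernel has derivative \<open>b * lap b (y - u)\<close> below \<open>y\<close> and minus this above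
  \<open>y\<close>; integrated from \<open>x\<close> to infinity, the derivative gives
  \<open>- lap b (y - x)\<close>. For \<open>x > y\<close> the integral on the left
  vanishes.\<close>

lemma lap_by_parts_point:
  assumes "b > 0"
  shows "ennreal (lap b (y - x))
      + (\<integral>\<^sup>+u. ennreal (b * lap b (y - u)) * indicator {..y} u * indicator {x<..} u \<partial>lborel)
      = (\<integral>\<^sup>+u. ennreal (b * lap b (y - u)) * indicator {y<..} u * indicator {x<..} u \<partial>lborel)"
proof (cases "x \<le> y")
  case True
  have 1: "(\<integral>\<^sup>+u. ennreal (b * lap b (y - u)) * indicator {..y} u * indicator {x<..} u \<partial>lborel)
    = (\<integral>\<^sup>+u. ennreal (b * lap b (y - u)) * indicator {x..y} u \<partial>lborel)"
    using AE_lborel_singleton[of x] by (intro nn_integral_cong_AE, eventually_elim) (auto split: split_indicator)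
  have 2: "(\<integral>\<^sup>+u. ennreal (b * lap b (y - u)) * indicator {y<..} u * indicator {x<..} u \<partial>lborel)
    = (\<integral>\<^sup>+u. ennreal (b * lap b (y - u)) * indicator {y..} u \<partial>lborel)"
    using AE_lborel_singleton[of y] by (intro nn_integral_cong_AE, eventually_elim) (use True in \<open>auto split: split_indicator\<close>)
  have "lap b (y - x) \<le> 1"
    using assms by (simp add: lap_def)
  then show ?thesis
    unfolding 1 2 using assms True
    by (simp add: nn_integral_lap_above nn_integral_lap_between flip: ennreal_plus) (simp add: lap_def)
next
  case False
  have 1: "(\<integral>\<^sup>+u. ennreal (b * lap b (y - u)) * indicator {..y} u * indicator {x<..} u \<partial>lborel)
    = (\<integral>\<^sup>+(u::real). 0 \<partial>lborel)"
    using False by (intro nn_integral_cong) (auto split: split_indicator)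
  have 2: "(\<integral>\<^sup>+u. ennreal (b * lap b (y - u)) * indicator {y<..} u * indicator {x<..} u \<partial>lborel)
    = (\<integral>\<^sup>+u. ennreal (b * lap b (y - u)) * indicator {x..} u \<partial>lborel)"
    using AE_lborel_singleton[of x] by (intro nn_integral_cong_AE, eventually_elim) (use False in \<open>auto split: split_indicator\<close>)
  show ?thesis
    unfolding 1 2 using assms False by (simp add: nn_integral_lap_above)
qed

text \<open>Integration by parts against \<open>\<nu>\<close>, with the negative part of the derivative of the kernel moved
  to the left so that everything makes sense in the extended nonnegative reals.\<close>

lemma lap_by_parts:
  assumes \<nu>: "sigma_finite_measure \<nu>" "sets \<nu> = sets borel" and "b > 0"
  shows "(\<integral>\<^sup>+x. ennreal (lap b (y - x)) \<partial>\<nu>)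
      + (\<integral>\<^sup>+u. ennreal (b * lap b (y - u)) * indicator {..y} u * emeasure \<nu> {..<u} \<partial>lborel)
      = (\<integral>\<^sup>+u. ennreal (b * lap b (y - u)) * indicator {y<..} u * emeasure \<nu> {..<u} \<partial>lborel)"
proof -
  interpret sigma_finite_measure \<nu> by fact
  interpret P: pair_sigma_finite lborel \<nu> ..
  note [measurable_cong] = \<nu>(2)
  \<comment> \<open>Tonelli trades the distribution function for an integral over
    \<open>\<nu>\<close> of point masses. The condition \<open>x < u\<close> is written as a
    conditional so that joint measurability is found automatically.\<close>
  have swap: "(\<integral>\<^sup>+u. ennreal (b * lap b (y - u)) * indicator A u * emeasure \<nu> {..<u} \<partial>lborel)
      = (\<integral>\<^sup>+x. (\<integral>\<^sup>+u. ennreal (b * lap b (y - u)) * indicator A u * indicator {x<..} u \<partial>lborel) \<partial>\<nu>)"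
    if [measurable]: "A \<in> sets borel" for A
  proof -
    have "(\<integral>\<^sup>+u. ennreal (b * lap b (y - u)) * indicator A u * emeasure \<nu> {..<u} \<partial>lborel)
      = (\<integral>\<^sup>+u. (\<integral>\<^sup>+x. ennreal (b * lap b (y - u)) * indicator A u * (if x < u then 1 else 0) \<partial>\<nu>) \<partial>lborel)"
    proof (rule nn_integral_cong)
      fix u :: real
      have "emeasure \<nu> {..<u} = (\<integral>\<^sup>+x. indicator {..<u} x \<partial>\<nu>)"
        using \<nu>(2) by simp
      also have "\<dots> = (\<integral>\<^sup>+x. (if x < u then 1 else 0) \<partial>\<nu>)"
        by (intro nn_integral_cong) (auto split: split_indicator)
      finally show "ennreal (b * lap b (y - u)) * indicator A u * emeasure \<nu> {..<u}
        = (\<integral>\<^sup>+x. ennreal (b * lap b (y - u)) * indicator A u * (if x < u then 1 else 0) \<partial>\<nu>)"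
        by (subst nn_integral_cmult) simp_all
    qed
    also have "\<dots> = (\<integral>\<^sup>+x. (\<integral>\<^sup>+u. ennreal (b * lap b (y - u)) * indicator A u * (if x < u then 1 else 0) \<partial>lborel) \<partial>\<nu>)"
      by (rule P.Fubini'[symmetric]) measurable
    also have "\<dots> = (\<integral>\<^sup>+x. (\<integral>\<^sup>+u. ennreal (b * lap b (y - u)) * indicator A u * indicator {x<..} u \<partial>lborel) \<partial>\<nu>)"
      by (intro nn_integral_cong) (auto split: split_indicator)
    finally show ?thesis .
  qed
  have meas: "(\<lambda>x. \<integral>\<^sup>+u. ennreal (b * lap b (y - u)) * indicator {..y} u * indicator {x<..} u \<partial>lborel)
      \<in> borel_measurable \<nu>"
  proof -
    have "(\<lambda>x. \<integral>\<^sup>+u. ennreal (b * lap b (y - u)) * indicator {..y} u * (if x < u then 1 else 0) \<partial>lborel)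
      \<in> borel_measurable \<nu>"
      by measurable
    also have "(\<lambda>x. \<integral>\<^sup>+u. ennreal (b * lap b (y - u)) * indicator {..y} u * (if x < u then 1 else 0) \<partial>lborel)
      = (\<lambda>x. \<integral>\<^sup>+u. ennreal (b * lap b (y - u)) * indicator {..y} u * indicator {x<..} u \<partial>lborel)"
      by (intro ext nn_integral_cong) (auto split: split_indicator)
    finally show ?thesis .
  qed
  show ?thesis
    unfolding swap[OF atMost_borel] swap[OF greaterThan_borel]
    by (subst nn_integral_add[OF _ meas, symmetric])
       (simp_all add: lap_by_parts_point[OF \<open>b > 0\<close>])
qed

lemma sigma_finite_measure_lessThan:
  fixes \<nu> :: "real measure"
  assumes sets: "sets \<nu> = sets borel" and emeasure_finite: "\<And>u. emeasure \<nu> {..<u} < \<infinity>"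
  shows "sigma_finite_measure \<nu>"
proof
  let ?A = "range (\<lambda>n::nat. {..<real n})"
  have "space \<nu> = UNIV"
    using sets_eq_imp_space_eq[OF sets] by simp
  moreover have "\<Union> ?A = UNIV"
    using reals_Archimedean2 by auto
  moreover have "?A \<subseteq> sets \<nu>"
    unfolding sets by auto
  moreover have "\<forall>A\<in>?A. emeasure \<nu> A \<noteq> \<infinity>"
    using emeasure_finite by (auto simp: less_top[symmetric])
  ultimately show "\<exists>A. countable A \<and> A \<subseteq> sets \<nu> \<and> \<Union> A = space \<nu> \<and> (\<forall>a\<in>A. emeasure \<nu> a \<noteq> \<infinity>)"
    by (intro exI[of _ ?A]) simp
qed

section \<open>The comparison measure: Lebesgue measure on the positive half-line\<close>

lemma emeasure_lborel_pos: "emeasure (density lborel (indicator {0<..})) {..<u} = ennreal (max 0 u)"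
proof -
  have "emeasure (density lborel (indicator {0<..})) {..<u} = emeasure lborel ({0<..} \<inter> {..<u})"
    by (rule emeasure_restricted) auto
  also have "\<dots> = emeasure lborel {0<..<u}"
    by (simp add: greaterThanLessThan_def)
  also have "\<dots> = ennreal (max 0 u)"
    by (cases "u \<ge> 0") auto
  finally show ?thesis .
qed

text \<open>The kernel smoothed against the comparison measure, whose distribution function is
  \<open>max 0 u\<close>; this is the main term with which \<open>lap_conv\<close> is compared
  below.\<close>

definition lap_mass :: "real \<Rightarrow> real \<Rightarrow> ennreal" where
  "lap_mass b y = (\<integral>\<^sup>+x. ennreal (lap b (y - x)) \<partial>density lborel (indicator {0<..}))"

lemma lap_mass_eq: "lap_mass b y = (\<integral>\<^sup>+x. ennreal (lap b (y - x)) * indicator {0<..} x \<partial>lborel)"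
  unfolding lap_mass_def by (subst nn_integral_density) (simp_all add: mult.commute)

lemma lap_mass_le:
  assumes "b > 0"
  shows "ennreal b * lap_mass b y \<le> 2"
proof -
  have "ennreal b * lap_mass b y = (\<integral>\<^sup>+x. ennreal b * (ennreal (lap b (y - x)) * indicator {0<..} x) \<partial>lborel)"
    unfolding lap_mass_eq by (subst nn_integral_cmult) simp_all
  also have "\<dots> \<le> (\<integral>\<^sup>+x. ennreal (b * lap b (y - x)) \<partial>lborel)"
    using assms by (intro nn_integral_mono) (auto simp: ennreal_mult split: split_indicator)
  finally show ?thesis
    using assms by (simp add: nn_integral_lap)
qed

text \<open>The half of the kernel to the right of \<open>y\<close> lies in the positive half-line
  and already has mass 1.\<close>

lemma lap_mass_ge:
  assumes "b > 0" "y \<ge> 0"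
  shows "1 \<le> ennreal b * lap_mass b y"
proof -
  have "1 = (\<integral>\<^sup>+x. ennreal (b * lap b (y - x)) * indicator {y..} x \<partial>lborel)"
    using assms(1) by (simp add: nn_integral_lap_above) (simp add: lap_def)
  also have "\<dots> \<le> (\<integral>\<^sup>+x. ennreal b * (ennreal (lap b (y - x)) * indicator {0<..} x) \<partial>lborel)"
    using AE_lborel_singleton[of y]
    by (intro nn_integral_mono_AE, eventually_elim)
       (use assms in \<open>auto simp: ennreal_mult split: split_indicator\<close>)
  also have "\<dots> = ennreal b * lap_mass b y"
    unfolding lap_mass_eq by (subst nn_integral_cmult) simp_all
  finally show ?thesis .
qed

section \<open>Measures with an approximate renewal equation\<close>

text \<open>In the application \<open>F z\<close> is N(e^z) e^(-z), \<open>\<mu>\<close> has mass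
  \<Lambda>(n)/n at log n, and \<open>G\<close> is their convolution. Since \<open>F\<close>
  vanishes for \<open>z \<le> 0\<close>, the convolution at \<open>u\<close> involves only the part
  of \<open>\<mu>\<close> below \<open>u\<close>. The lower bound \<open>m\<close> makes
  \<open>\<mu>\<close> finite on left half-lines.\<close>

locale renewal_measure =
  fixes \<mu> :: "real measure" and a B m :: real and F G :: "real \<Rightarrow> real"
  assumes sets_mu [measurable_cong]: "sets \<mu> = sets borel"
    and mu_pos: "AE x in \<mu>. 0 < x"
    and a_pos: "a > 0" and m_pos: "m > 0"
    and F_measurable [measurable]: "F \<in> borel_measurable borel"
    and F_nonpos: "\<And>z. z \<le> 0 \<Longrightarrow> F z = 0"
    and F_ge: "\<And>z. 0 < z \<Longrightarrow> m \<le> F z"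
    and F_integrable: "(\<integral>\<^sup>+z. ennreal \<bar>F z - a * indicator {0<..} z\<bar> \<partial>lborel) < \<infinity>"
    and F_conv: "\<And>u. (\<integral>\<^sup>+v. ennreal (F (u - v)) \<partial>\<mu>) = ennreal (G u)"
    and G_approx: "\<And>u. \<bar>G u - a * max 0 u\<bar> \<le> B"
begin

definition err :: "real \<Rightarrow> real" where
  "err z = \<bar>F z - a * indicator {0<..} z\<bar>"

definition err_conv :: "real \<Rightarrow> ennreal" where
  "err_conv u = (\<integral>\<^sup>+v. ennreal (err (u - v)) \<partial>\<mu>)"

definition lap_conv :: "real \<Rightarrow> real \<Rightarrow> ennreal" where
  "lap_conv b y = (\<integral>\<^sup>+x. ennreal (lap b (y - x)) \<partial>\<mu>)"

lemma err_measurable [measurable]: "err \<in> borel_measurable borel"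
  unfolding err_def by measurable

lemma err_nonneg [simp]: "err z \<ge> 0"
  by (simp add: err_def)

lemma B_nonneg: "B \<ge> 0"
  using G_approx[of 0] by linarith

lemma F_nonneg: "F z \<ge> 0"
  using F_nonpos[of z] F_ge[of z] m_pos by (cases "z \<le> 0") auto

section \<open>The distribution function of \<open>\<mu>\<close>\<close>

lemma emeasure_eq: "emeasure \<mu> {..<u} = (\<integral>\<^sup>+v. indicator {0<..} (u - v) \<partial>\<mu>)"
proof -
  have "emeasure \<mu> {..<u} = (\<integral>\<^sup>+v. indicator {..<u} v \<partial>\<mu>)"
    using sets_mu by simp
  also have "\<dots> = (\<integral>\<^sup>+v. indicator {0<..} (u - v) \<partial>\<mu>)"
    by (intro nn_integral_cong) (auto split: split_indicator)
  finally show ?thesis .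
qed

text \<open>Obtained by convolving \<open>m * indicator {0<..} z \<le> F z\<close> with
  \<open>\<mu>\<close>. This crude linear bound serves to secure finiteness.\<close>

lemma emeasure_le: "ennreal m * emeasure \<mu> {..<u} \<le> ennreal (a * max 0 u + B)"
proof -
  have "ennreal m * emeasure \<mu> {..<u} = (\<integral>\<^sup>+v. ennreal m * indicator {0<..} (u - v) \<partial>\<mu>)"
    unfolding emeasure_eq by (subst nn_integral_cmult) simp_all
  also have "\<dots> \<le> (\<integral>\<^sup>+v. ennreal (F (u - v)) \<partial>\<mu>)"
    using F_ge by (intro nn_integral_mono) (auto split: split_indicator intro!: ennreal_leI)
  also have "\<dots> \<le> ennreal (a * max 0 u + B)"
    unfolding F_conv using G_approx[of u] by (intro ennreal_leI) linarith
  finally show ?thesis .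
qed

lemma emeasure_bound: "emeasure \<mu> {..<u} \<le> ennreal ((a * max 0 u + B) / m)"
proof -
  have "emeasure \<mu> {..<u} = ennreal (1 / m) * (ennreal m * emeasure \<mu> {..<u})"
    using m_pos by (simp add: mult.assoc[symmetric] flip: ennreal_mult)
  also have "\<dots> \<le> ennreal (1 / m) * ennreal (a * max 0 u + B)"
    by (intro mult_left_mono emeasure_le) simp
  also have "\<dots> = ennreal ((a * max 0 u + B) / m)"
    using m_pos by (simp flip: ennreal_mult')
  finally show ?thesis .
qed

lemma emeasure_finite: "emeasure \<mu> {..<u} < \<infinity>"
  using emeasure_bound[of u] by (simp add: order_le_less_trans)

lemma sigma_finite_mu: "sigma_finite_measure \<mu>"
  by (rule sigma_finite_measure_lessThan[OF sets_mu emeasure_finite])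

sublocale sigma_finite_measure \<mu> by (rule sigma_finite_mu)

sublocale pair: pair_sigma_finite lborel \<mu> ..

lemma err_conv_measurable [measurable]: "err_conv \<in> borel_measurable borel"
  unfolding err_conv_def by measurable

lemma lap_conv_measurable [measurable]: "lap_conv b \<in> borel_measurable borel"
  unfolding lap_conv_def by measurable

lemma emeasure_measurable [measurable]: "(\<lambda>u. emeasure \<mu> {..<u}) \<in> borel_measurable borel"
  unfolding emeasure_eq by measurable

text \<open>Comes from \<open>a * indicator {0<..} z \<le> F z + err z\<close>, convolved with
  \<open>\<mu>\<close>. Together with the next lemma it says that \<open>a * \<mu> {..<u}\<close>
  and \<open>a * max 0 u\<close> differ by at most \<open>B + err_conv u\<close>; two one-sided
  forms avoid subtraction in \<open>ennreal\<close>.\<close>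

lemma emeasure_le_err_conv:
  "ennreal a * emeasure \<mu> {..<u} \<le> ennreal a * ennreal (max 0 u) + (ennreal B + err_conv u)"
proof -
  have "ennreal a * emeasure \<mu> {..<u} = (\<integral>\<^sup>+v. ennreal a * indicator {0<..} (u - v) \<partial>\<mu>)"
    unfolding emeasure_eq by (subst nn_integral_cmult) simp_all
  also have "\<dots> \<le> (\<integral>\<^sup>+v. ennreal (F (u - v)) + ennreal (err (u - v)) \<partial>\<mu>)"
    by (intro nn_integral_mono)
       (auto split: split_indicator intro!: ennreal_leI simp: err_def F_nonneg simp flip: ennreal_plus)
  also have "\<dots> = ennreal (G u) + err_conv u"
    unfolding err_conv_def F_conv[symmetric] by (subst nn_integral_add) simp_all
  also have "\<dots> \<le> ennreal (a * max 0 u + B) + err_conv u"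
    using G_approx[of u] by (intro add_right_mono ennreal_leI) linarith
  also have "\<dots> = ennreal a * ennreal (max 0 u) + (ennreal B + err_conv u)"
    using a_pos B_nonneg by (simp add: ennreal_plus ennreal_mult add.assoc)
  finally show ?thesis .
qed

text \<open>The mirror estimate, from
  \<open>F z \<le> a * indicator {0<..} z + err z\<close>.\<close>

lemma le_emeasure_err_conv:
  "ennreal a * ennreal (max 0 u) \<le> ennreal a * emeasure \<mu> {..<u} + (ennreal B + err_conv u)"
proof -
  have "ennreal a * ennreal (max 0 u) \<le> ennreal (G u + B)"
    using a_pos G_approx[of u] by (subst ennreal_mult[symmetric]) (auto intro!: ennreal_leI)
  \<comment> \<open>If \<open>G u\<close> is negative, \<open>ennreal\<close> truncates it to 0,
    which only enlarges the right-hand side.\<close>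
  also have "\<dots> \<le> ennreal (G u) + ennreal B"
    using B_nonneg by (cases "G u \<ge> 0") (auto simp: ennreal_plus ennreal_neg intro!: ennreal_leI)
  also have "ennreal (G u) = (\<integral>\<^sup>+v. ennreal (F (u - v)) \<partial>\<mu>)"
    by (rule F_conv[symmetric])
  also have "\<dots> \<le> (\<integral>\<^sup>+v. ennreal a * indicator {0<..} (u - v) + ennreal (err (u - v)) \<partial>\<mu>)"
    using a_pos F_nonpos
    by (intro nn_integral_mono)
       (auto split: split_indicator intro!: ennreal_leI simp: err_def simp flip: ennreal_plus)
  also have "\<dots> = ennreal a * emeasure \<mu> {..<u} + err_conv u"
    unfolding err_conv_def emeasure_eq by (subst nn_integral_add) (simp_all add: nn_integral_cmult)
  finally show ?thesis
    by (simp add: algebra_simps)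
qed

text \<open>Associativity of convolution, by Tonelli twice and the shift \<open>u = v + z\<close>.
  It moves the kernel from the error onto \<open>\<mu>\<close>, so that \<open>lap_conv\<close>
  itself reappears in the error term.\<close>

lemma nn_integral_lap_err_conv:
  "(\<integral>\<^sup>+u. ennreal (lap b (y - u)) * err_conv u \<partial>lborel) = (\<integral>\<^sup>+z. ennreal (err z) * lap_conv b (y - z) \<partial>lborel)"
proof -
  have "(\<integral>\<^sup>+u. ennreal (lap b (y - u)) * err_conv u \<partial>lborel)
    = (\<integral>\<^sup>+u. (\<integral>\<^sup>+v. ennreal (lap b (y - u)) * ennreal (err (u - v)) \<partial>\<mu>) \<partial>lborel)"
    unfolding err_conv_def by (subst nn_integral_cmult) simp_all
  also have "\<dots> = (\<integral>\<^sup>+v. (\<integral>\<^sup>+u. ennreal (lap b (y - u)) * ennreal (err (u - v)) \<partial>lborel) \<partial>\<mu>)"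
    by (rule pair.Fubini'[symmetric]) measurable
  also have "\<dots> = (\<integral>\<^sup>+v. (\<integral>\<^sup>+z. ennreal (lap b (y - z - v)) * ennreal (err z) \<partial>lborel) \<partial>\<mu>)"
  proof (rule nn_integral_cong)
    fix v
    show "(\<integral>\<^sup>+u. ennreal (lap b (y - u)) * ennreal (err (u - v)) \<partial>lborel)
      = (\<integral>\<^sup>+z. ennreal (lap b (y - z - v)) * ennreal (err z) \<partial>lborel)"
      by (subst nn_integral_real_affine[where t=v and c=1]) (simp_all add: algebra_simps)
  qed
  also have "\<dots> = (\<integral>\<^sup>+z. (\<integral>\<^sup>+v. ennreal (lap b (y - z - v)) * ennreal (err z) \<partial>\<mu>) \<partial>lborel)"
    by (rule pair.Fubini') measurable
  also have "\<dots> = (\<integral>\<^sup>+z. ennreal (err z) * lap_conv b (y - z) \<partial>lborel)"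
    unfolding lap_conv_def by (subst nn_integral_multc) (simp_all add: mult.commute)
  finally show ?thesis .
qed

text \<open>The error \<open>B + err_conv\<close> integrated against \<open>b * lap b\<close>; the
  factor 2 is the total mass of that kernel.\<close>

definition err_total :: "real \<Rightarrow> real \<Rightarrow> ennreal" where
  "err_total b y = 2 * ennreal B + ennreal b * (\<integral>\<^sup>+z. ennreal (err z) * lap_conv b (y - z) \<partial>lborel)"

lemma err_total_eq:
  assumes "b > 0"
  shows "(\<integral>\<^sup>+u. ennreal (b * lap b (y - u)) * (ennreal B + err_conv u) \<partial>lborel) = err_total b y"
proof -
  have "(\<integral>\<^sup>+u. ennreal (b * lap b (y - u)) * (ennreal B + err_conv u) \<partial>lborel)
      = (\<integral>\<^sup>+u. ennreal (b * lap b (y - u)) * ennreal B + ennreal b * (ennreal (lap b (y - u)) * err_conv u) \<partial>lborel)"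
    using assms by (intro nn_integral_cong) (simp add: ennreal_mult algebra_simps)
  also have "\<dots> = (\<integral>\<^sup>+u. ennreal (b * lap b (y - u)) \<partial>lborel) * ennreal B
       + ennreal b * (\<integral>\<^sup>+u. ennreal (lap b (y - u)) * err_conv u \<partial>lborel)"
    by (simp add: nn_integral_add nn_integral_multc nn_integral_cmult)
  also have "\<dots> = err_total b y"
    using assms by (simp add: nn_integral_lap nn_integral_lap_err_conv err_total_def)
  finally show ?thesis .
qed

text \<open>Compare integration by parts for \<open>\<mu>\<close> with the same formula for Lebesgue
  measure on the half-line: \<open>a\<close> times the distribution functions differ by at most
  \<open>B + err_conv\<close>, and the derivative of the kernel has absolute value
  \<open>b * lap b\<close>.\<close>

lemma
  assumes b: "b > 0"
  shows lap_conv_le_lap_mass: "ennreal a * lap_conv b y \<le> ennreal a * lap_mass b y + err_total b y"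
    and lap_mass_le_lap_conv: "ennreal a * lap_mass b y \<le> ennreal a * lap_conv b y + err_total b y"
proof -
  let ?k = "\<lambda>u. ennreal (b * lap b (y - u))"
  let ?lo = "\<lambda>u. ?k u * indicator {..y} u" and ?up = "\<lambda>u. ?k u * indicator {y<..} u"
  \<comment> \<open>\<open>L\<close> and \<open>U\<close> integrate against the derivative below and
    above \<open>y\<close>, where it has opposite signs.\<close>
  define L where "L h = (\<integral>\<^sup>+u. ?lo u * h u \<partial>lborel)" for h
  define U where "U h = (\<integral>\<^sup>+u. ?up u * h u \<partial>lborel)" for h
  let ?P = "\<lambda>u. emeasure \<mu> {..<u}" and ?I = "\<lambda>u. ennreal (max 0 u)" and ?e = "\<lambda>u. ennreal B + err_conv u"
  have 1: "lap_conv b y + L ?P = U ?P"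
    unfolding lap_conv_def L_def U_def by (rule lap_by_parts[OF sigma_finite_mu sets_mu b])
  have sf: "sigma_finite_measure (density lborel (indicator {0<..} :: real \<Rightarrow> ennreal))"
    by (rule sigma_finite_measure_lessThan) (simp_all add: emeasure_lborel_pos)
  have 2: "lap_mass b y + L ?I = U ?I"
    using lap_by_parts[OF sf _ b, of y]
    unfolding lap_mass_def L_def U_def emeasure_lborel_pos by simp
  have UL: "U ?e + L ?e = err_total b y"
    unfolding err_total_eq[OF b, symmetric] U_def L_def
    by (subst nn_integral_add[symmetric]) (auto intro!: nn_integral_cong split: split_indicator)
  \<comment> \<open>The lower parts are the terms that \<open>combine\<close> cancels, so their
    finiteness matters; on \<open>u \<le> y\<close> both distribution functions are bounded.\<close>
  have fin: "L h < \<infinity>" if "\<And>u. u \<le> y \<Longrightarrow> h u \<le> ennreal c" for h c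
  proof -
    have "L h \<le> (\<integral>\<^sup>+u. ?k u * ennreal c \<partial>lborel)"
      unfolding L_def using that by (intro nn_integral_mono) (auto intro!: mult_left_mono split: split_indicator)
    also have "\<dots> = 2 * ennreal c"
      using b by (simp add: nn_integral_multc nn_integral_lap)
    finally show ?thesis
      by (simp add: order_le_less_trans ennreal_mult_less_top)
  qed
  have finP: "L ?P < \<infinity>"
  proof (rule fin)
    fix u assume "u \<le> y"
    then have "?P u \<le> ?P y" using sets_mu by (intro emeasure_mono) auto
    also note emeasure_bound
    finally show "?P u \<le> ennreal ((a * max 0 y + B) / m)" .
  qed
  have finI: "L ?I < \<infinity>"
    by (rule fin[of _ "max 0 y"]) (auto intro!: ennreal_leI)
  have lin: "a * L h1 \<le> a * L h2 + L h3" "a * U h1 \<le> a * U h2 + U h3"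
    if le: "\<And>u. ennreal a * h1 u \<le> ennreal a * h2 u + h3 u"
      and [measurable]: "h1 \<in> borel_measurable borel" "h2 \<in> borel_measurable borel" "h3 \<in> borel_measurable borel"
    for h1 h2 h3
  proof -
    have *: "ennreal a * (\<integral>\<^sup>+u. g u * h1 u \<partial>lborel)
       \<le> ennreal a * (\<integral>\<^sup>+u. g u * h2 u \<partial>lborel) + (\<integral>\<^sup>+u. g u * h3 u \<partial>lborel)"
      if [measurable]: "g \<in> borel_measurable borel" for g :: "real \<Rightarrow> ennreal"
    proof -
      have "ennreal a * (\<integral>\<^sup>+u. g u * h1 u \<partial>lborel) = (\<integral>\<^sup>+u. g u * (ennreal a * h1 u) \<partial>lborel)"
        by (subst nn_integral_cmult[symmetric]) (auto simp: ac_simps)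
      also have "\<dots> \<le> (\<integral>\<^sup>+u. g u * (ennreal a * h2 u + h3 u) \<partial>lborel)"
        by (intro nn_integral_mono mult_left_mono le) simp
      also have "\<dots> = (\<integral>\<^sup>+u. ennreal a * (g u * h2 u) + g u * h3 u \<partial>lborel)"
        by (intro nn_integral_cong) (simp add: algebra_simps)
      also have "\<dots> = ennreal a * (\<integral>\<^sup>+u. g u * h2 u \<partial>lborel) + (\<integral>\<^sup>+u. g u * h3 u \<partial>lborel)"
        by (simp add: nn_integral_add nn_integral_cmult)
      finally show ?thesis .
    qed
    show "a * L h1 \<le> a * L h2 + L h3" "a * U h1 \<le> a * U h2 + U h3"
      unfolding L_def U_def by (rule *, measurable)+
  qed
  \<comment> \<open>Adding the lower parts of both measures to each side removes all subtractions;
    their sum \<open>?c\<close> is finite and cancels at the end. The statement is symmetric in the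
    two measures, so it gives both inequalities.\<close>
  have combine: "ennreal a * p1 \<le> ennreal a * p2 + err_total b y"
    if "p1 + L h1 = U h1" "p2 + L h2 = U h2" "L h1 < \<infinity>" "L h2 < \<infinity>"
      "\<And>u. ennreal a * h1 u \<le> ennreal a * h2 u + ?e u"
      "\<And>u. ennreal a * h2 u \<le> ennreal a * h1 u + ?e u"
      and [measurable]: "h1 \<in> borel_measurable borel" "h2 \<in> borel_measurable borel" for p1 p2 h1 h2
  proof -
    let ?c = "ennreal a * L h1 + ennreal a * L h2"
    have "ennreal a * p1 + ?c = ennreal a * U h1 + ennreal a * L h2"
      by (simp add: that(1)[symmetric] algebra_simps)
    also have "\<dots> \<le> (ennreal a * U h2 + U ?e) + (ennreal a * L h1 + L ?e)"
      by (intro add_mono lin that) measurable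
    also have "\<dots> = ennreal a * p2 + err_total b y + ?c"
      by (simp add: that(2)[symmetric] UL[symmetric] algebra_simps)
    finally have "?c + ennreal a * p1 \<le> ?c + (ennreal a * p2 + err_total b y)"
      by (simp only: add.commute)
    moreover have "?c \<noteq> \<infinity>"
      using that(3,4) by (simp add: ennreal_mult_eq_top_iff less_top[symmetric])
    ultimately show ?thesis
      by (simp only: ennreal_add_left_cancel_le) blast
  qed
  show "ennreal a * lap_conv b y \<le> ennreal a * lap_mass b y + err_total b y"
    by (rule combine[OF 1 2 finP finI emeasure_le_err_conv le_emeasure_err_conv]) measurable
  show "ennreal a * lap_mass b y \<le> ennreal a * lap_conv b y + err_total b y"
    by (rule combine[OF 2 1 finI finP le_emeasure_err_conv emeasure_le_err_conv]) measurable
qed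

section \<open>A priori finiteness of the smoothed measure\<close>

lemma lap_conv_0_finite:
  assumes b: "b > 0"
  shows "lap_conv b 0 < \<infinity>"
proof -
  \<comment> \<open>Half of the exponent is spent on the linear growth of
    \<open>\<mu> {..<u}\<close>, through \<open>u * exp (- (b / 2 * u)) \<le> 2 / b\<close>; the
    other half stays integrable.\<close>
  define K where "K = 2 * (2 * a / b + B) / m"
  have "K \<ge> 0"
    using a_pos b B_nonneg m_pos by (simp add: K_def)
  have bound: "b * lap b u * ((a * u + B) / m) \<le> K * (b / 2 * lap (b / 2) u)" if "u > 0" for u
  proof -
    have "b / 2 * u \<le> exp (b / 2 * u)"
      using exp_ge_add_one_self[of "b / 2 * u"] by linarith
    then have "u * exp (- (b / 2 * u)) \<le> 2 / b"
      using b by (simp add: exp_minus field_simps)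
    then have "a * (u * exp (- (b / 2 * u))) \<le> a * (2 / b)"
      using a_pos by (intro mult_left_mono) auto
    moreover have "B * exp (- (b / 2 * u)) \<le> B * 1"
      using b that B_nonneg by (intro mult_left_mono) auto
    ultimately have *: "(a * u + B) * exp (- (b / 2 * u)) \<le> 2 * a / b + B"
      by (simp add: algebra_simps)
    have "lap b u = lap (b / 2) u * exp (- (b / 2 * u))"
      using that by (simp add: lap_def flip: exp_add)
    then have "b * lap b u * ((a * u + B) / m)
        = (b / m * lap (b / 2) u) * ((a * u + B) * exp (- (b / 2 * u)))"
      by simp
    also have "\<dots> \<le> (b / m * lap (b / 2) u) * (2 * a / b + B)"
      using b m_pos by (intro mult_left_mono[OF *]) auto
    also have "\<dots> = K * (b / 2 * lap (b / 2) u)"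
      by (simp add: K_def algebra_simps add_divide_distrib)
    finally show ?thesis .
  qed
  \<comment> \<open>Integration by parts at 0, with the second nonnegative term on the left
    dropped.\<close>
  have "lap_conv b 0 \<le> (\<integral>\<^sup>+u. ennreal (b * lap b (0 - u)) * indicator {0<..} u * emeasure \<mu> {..<u} \<partial>lborel)"
    unfolding lap_by_parts[OF sigma_finite_mu sets_mu b, of 0, symmetric] lap_conv_def by simp
  also have "\<dots> \<le> (\<integral>\<^sup>+u. ennreal K * ennreal (b / 2 * lap (b / 2) (0 - u)) \<partial>lborel)"
  proof (rule nn_integral_mono)
    fix u
    show "ennreal (b * lap b (0 - u)) * indicator {0<..} u * emeasure \<mu> {..<u}
      \<le> ennreal K * ennreal (b / 2 * lap (b / 2) (0 - u))"
    proof (cases "u > 0")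
      case True
      have "ennreal (b * lap b (0 - u)) * indicator {0<..} u * emeasure \<mu> {..<u}
        \<le> ennreal (b * lap b u) * ennreal ((a * u + B) / m)"
        using emeasure_bound[of u] True by (auto intro!: mult_left_mono)
      also have "\<dots> = ennreal (b * lap b u * ((a * u + B) / m))"
        using b by (intro ennreal_mult'[symmetric]) simp
      also have "\<dots> \<le> ennreal (K * (b / 2 * lap (b / 2) u))"
        by (intro ennreal_leI bound True)
      also have "\<dots> = ennreal K * ennreal (b / 2 * lap (b / 2) (0 - u))"
        using \<open>K \<ge> 0\<close> by (subst ennreal_mult') simp_all
      finally show ?thesis .
    qed simp
  qed
  also have "\<dots> = ennreal K * 2"
    using b nn_integral_lap[of "b / 2" 0] by (subst nn_integral_cmult) simp_all
  also have "\<dots> < \<infinity>"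
    by (simp add: ennreal_mult_less_top)
  finally show ?thesis .
qed

text \<open>\<open>\<mu>\<close> lives on \<open>x > 0\<close>, where
  \<open>\<bar>y - x\<bar> \<ge> x - Y\<close>. The bound is uniform in \<open>y \<le> Y\<close>,
  which makes the supremum used for the absorption finite.\<close>

lemma lap_conv_le_lap_conv_0:
  assumes "b > 0" "y \<le> Y" "Y \<ge> 0"
  shows "lap_conv b y \<le> ennreal (exp (b * Y)) * lap_conv b 0"
proof -
  have "lap_conv b y \<le> (\<integral>\<^sup>+x. ennreal (exp (b * Y)) * ennreal (lap b (0 - x)) \<partial>\<mu>)"
    unfolding lap_conv_def using mu_pos
  proof (intro nn_integral_mono_AE, eventually_elim)
    fix x :: real assume "0 < x"
    have "b * (x - Y) \<le> b * \<bar>y - x\<bar>"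
      using assms by (intro mult_left_mono) auto
    then have "lap b (y - x) \<le> exp (b * Y) * lap b (0 - x)"
      using \<open>0 < x\<close> by (simp add: lap_def algebra_simps flip: exp_add)
    then show "ennreal (lap b (y - x)) \<le> ennreal (exp (b * Y)) * ennreal (lap b (0 - x))"
      by (simp add: ennreal_leI flip: ennreal_mult)
  qed
  also have "\<dots> = ennreal (exp (b * Y)) * lap_conv b 0"
    unfolding lap_conv_def by (subst nn_integral_cmult) simp_all
  finally show ?thesis .
qed

section \<open>Absorbing the error: upper and lower bounds for the smoothed measure\<close>

definition err_norm :: real where
  "err_norm = enn2real (\<integral>\<^sup>+z. ennreal (err z) \<partial>lborel)"

lemma err_norm_nonneg: "err_norm \<ge> 0"
  by (simp add: err_norm_def)

lemma nn_integral_err: "(\<integral>\<^sup>+z. ennreal (err z) \<partial>lborel) = ennreal err_norm"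
  using F_integrable unfolding err_norm_def err_def by (subst ennreal_enn2real) auto

text \<open>Since \<open>err z\<close> vanishes for \<open>z \<le> 0\<close>, only values of
  \<open>lap_conv\<close> to the left of \<open>y\<close> enter, weighted by a function of integral
  \<open>err_norm\<close>.\<close>

lemma err_total_le:
  assumes "b > 0" "r \<ge> 0" and le: "\<And>y'. y' \<le> y \<Longrightarrow> lap_conv b y' \<le> ennreal r"
  shows "err_total b y \<le> ennreal (2 * B + b * err_norm * r)"
proof -
  have "(\<integral>\<^sup>+z. ennreal (err z) * lap_conv b (y - z) \<partial>lborel) \<le> (\<integral>\<^sup>+z. ennreal (err z) * ennreal r \<partial>lborel)"
  proof (rule nn_integral_mono)
    fix z
    show "ennreal (err z) * lap_conv b (y - z) \<le> ennreal (err z) * ennreal r"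
    proof (cases "z > 0")
      case True
      then show ?thesis by (intro mult_left_mono le) auto
    next
      case False
      then have "err z = 0" by (simp add: err_def F_nonpos)
      then show ?thesis by simp
    qed
  qed
  also have "\<dots> = ennreal err_norm * ennreal r"
    by (subst nn_integral_multc) (simp_all add: nn_integral_err)
  finally have "err_total b y \<le> 2 * ennreal B + ennreal b * (ennreal err_norm * ennreal r)"
    unfolding err_total_def by (intro add_left_mono mult_left_mono) auto
  also have "\<dots> = ennreal (2 * B + b * err_norm * r)"
    using assms(1,2) err_norm_nonneg B_nonneg by (simp add: ennreal_plus ennreal_mult mult.assoc)
  finally show ?thesis .
qed

text \<open>Since \<open>err\<close> lives on the positive half-line, the supremum over \<open>{..Y}\<close>, which is finite a
  priori, is enough to absorb the error; the resulting bound does not depend on \<open>Y\<close>.\<close>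

lemma lap_conv_upper:
  assumes b: "b > 0" "b * err_norm \<le> a / 2"
  shows "lap_conv b y \<le> ennreal (4 / b + 4 * B / a)"
proof -
  define Y where "Y = max 0 y"
  define A where "A = (SUP y\<in>{..Y}. lap_conv b y)"
  have "A \<le> ennreal (exp (b * Y)) * lap_conv b 0"
    unfolding A_def using b by (intro SUP_least lap_conv_le_lap_conv_0) (auto simp: Y_def)
  also have "\<dots> < \<infinity>"
    using lap_conv_0_finite[OF b(1)] by (simp add: ennreal_mult_less_top)
  finally obtain r where r: "r \<ge> 0" "A = ennreal r"
    by (cases A) auto
  have le: "lap_conv b y' \<le> ennreal r" if "y' \<le> Y" for y'
    unfolding r(2)[symmetric] A_def using that by (intro SUP_upper) auto
  have lap_mass: "lap_mass b y' \<le> ennreal (2 / b)" for y'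
  proof -
    have "lap_mass b y' = ennreal (1 / b) * (ennreal b * lap_mass b y')"
      using b by (simp add: mult.assoc[symmetric] flip: ennreal_mult)
    also have "\<dots> \<le> ennreal (1 / b) * 2"
      by (intro mult_left_mono lap_mass_le b) simp
    also have "\<dots> = ennreal (2 / b)"
      using b by (simp flip: ennreal_mult' ennreal_numeral)
    finally show ?thesis .
  qed
  have "lap_conv b y' \<le> ennreal ((2 * a / b + 2 * B + b * err_norm * r) / a)" if "y' \<le> Y" for y'
  proof -
    have "lap_conv b y' = ennreal (1 / a) * (ennreal a * lap_conv b y')"
      using a_pos by (simp add: mult.assoc[symmetric] flip: ennreal_mult)
    also have "ennreal a * lap_conv b y' \<le> ennreal a * lap_mass b y' + err_total b y'"
      by (rule lap_conv_le_lap_mass[OF b(1)])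
    also have "\<dots> \<le> ennreal a * ennreal (2 / b) + ennreal (2 * B + b * err_norm * r)"
      using that by (intro add_mono mult_left_mono lap_mass err_total_le b r le) auto
    also have "\<dots> = ennreal (2 * a / b + 2 * B + b * err_norm * r)"
      using a_pos b(1) B_nonneg err_norm_nonneg r(1)
      by (simp add: ennreal_mult[symmetric] ennreal_plus[symmetric] add.assoc mult.commute del: ennreal_plus)
    finally show ?thesis
      using a_pos by (simp add: mult_left_mono flip: ennreal_mult')
  qed
  then have "A \<le> ennreal ((2 * a / b + 2 * B + b * err_norm * r) / a)"
    unfolding A_def by (intro SUP_least) auto
  then have "r \<le> (2 * a / b + 2 * B + b * err_norm * r) / a"
    unfolding r(2) using a_pos b(1) B_nonneg err_norm_nonneg r(1) by (subst (asm) ennreal_le_iff) auto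
  then have "a * r \<le> 2 * a / b + 2 * B + (b * err_norm) * r"
    using a_pos by (simp add: field_simps)
  \<comment> \<open>By the choice of \<open>b\<close>, at most half of \<open>a * r\<close> returns
    on the right and can be absorbed.\<close>
  also have "(b * err_norm) * r \<le> a / 2 * r"
    using b r by (intro mult_right_mono) auto
  finally have "a * r \<le> 2 * (2 * a / b + 2 * B)"
    by simp
  then have "r \<le> 2 * (2 * a / b + 2 * B) / a"
    using a_pos by (simp add: field_simps)
  also have "\<dots> = 4 / b + 4 * B / a"
    using a_pos by (simp add: field_simps)
  finally have "r \<le> 4 / b + 4 * B / a" .
  then show ?thesis
    using le[of y] ennreal_leI order_trans unfolding Y_def by fastforce
qed

text \<open>The main term \<open>a / b\<close> grows as \<open>b\<close> tends to 0, whereas the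
  error stays below \<open>4 * B + 4 * err_norm\<close>. The third condition on \<open>b\<close>
  makes this at most half of the main term.\<close>

lemma lap_conv_lower:
  assumes b: "b > 0" "b * err_norm \<le> a / 2" "2 * b * (4 * B + 4 * err_norm) \<le> a" and "y \<ge> 0"
  shows "ennreal (1 / (2 * b)) \<le> lap_conv b y"
proof -
  define R where "R = 4 / b + 4 * B / a"
  have "R \<ge> 0"
    using a_pos b B_nonneg by (simp add: R_def)
  have "lap_conv b y \<le> ennreal R"
    unfolding R_def by (rule lap_conv_upper[OF b(1,2)])
  then obtain p where p: "p \<ge> 0" "lap_conv b y = ennreal p"
    by (cases "lap_conv b y") (auto simp: top_unique)
  have "ennreal (a / b) = ennreal (a / b) * 1"
    by simp
  also have "\<dots> \<le> ennreal (a / b) * (ennreal b * lap_mass b y)"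
    by (intro mult_left_mono lap_mass_ge b assms) simp
  also have "\<dots> = ennreal a * lap_mass b y"
    using a_pos b by (simp add: mult.assoc[symmetric] flip: ennreal_mult)
  also have "\<dots> \<le> ennreal a * lap_conv b y + err_total b y"
    by (rule lap_mass_le_lap_conv[OF b(1)])
  also have "\<dots> \<le> ennreal a * ennreal p + ennreal (2 * B + b * err_norm * R)"
    unfolding p(2) using lap_conv_upper[OF b(1,2)] \<open>R \<ge> 0\<close>
    by (intro add_left_mono err_total_le b) (auto simp: R_def)
  also have "\<dots> = ennreal (a * p + (2 * B + b * err_norm * R))"
    using a_pos p b(1) B_nonneg err_norm_nonneg \<open>R \<ge> 0\<close> by (simp add: ennreal_plus ennreal_mult)
  finally have "a / b \<le> a * p + (2 * B + b * err_norm * R)"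
    using a_pos p b(1) B_nonneg err_norm_nonneg \<open>R \<ge> 0\<close> by (subst (asm) ennreal_le_iff) auto
  \<comment> \<open>The factor \<open>b\<close> cancels against \<open>4 / b\<close> in
    \<open>R\<close>; this is why the error does not grow as \<open>b\<close> shrinks.\<close>
  also have "b * err_norm * R = 4 * err_norm + (b * err_norm) * (4 * B / a)"
    using b by (simp add: R_def algebra_simps)
  also have "\<dots> \<le> 4 * err_norm + a / 2 * (4 * B / a)"
    using b a_pos B_nonneg by (intro add_left_mono mult_right_mono) auto
  finally have "a / b \<le> a * p + (4 * B + 4 * err_norm)"
    using a_pos by simp
  moreover have "4 * B + 4 * err_norm \<le> a / (2 * b)"
    using b by (simp add: field_simps)
  ultimately have "a / (2 * b) \<le> a * p"
    by (simp add: field_simps)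
  then have "a * (1 / (2 * b)) \<le> a * p"
    by simp
  then have "1 / (2 * b) \<le> p"
    by (rule mult_left_le_imp_le[OF _ a_pos])
  then show ?thesis
    unfolding p(2) by (rule ennreal_leI)
qed

section \<open>Passage to the one-sided kernel, which in the application yields psi(e^t) /
  e^t\<close>

definition exp_conv :: "real \<Rightarrow> ennreal" where
  "exp_conv t = (\<integral>\<^sup>+x. ennreal (exp (x - t)) * indicator {..<t} x \<partial>\<mu>)"

lemma exp_conv_le_lap_conv:
  assumes "b > 0" "b \<le> 1"
  shows "exp_conv t \<le> lap_conv b t"
  unfolding exp_conv_def lap_conv_def
proof (rule nn_integral_mono)
  fix x
  show "ennreal (exp (x - t)) * indicator {..<t} x \<le> ennreal (lap b (t - x))"
  proof (cases "x < t")
    case True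
    then have "b * (t - x) \<le> 1 * (t - x)"
      using assms by (intro mult_right_mono) auto
    then show ?thesis
      using True by (auto simp: lap_def algebra_simps intro!: ennreal_leI)
  qed simp
qed

text \<open>Within distance \<open>V\<close> of \<open>y\<close> the one-sided kernel ending at
  \<open>y + V\<close> is at least \<open>exp (- (2 * V))\<close>. Farther away, half of the
  exponent gives the small factor and the other half leaves the kernel with parameter
  \<open>b / 2\<close>.\<close>

lemma lap_conv_le_exp_conv:
  assumes "b > 0" "V > 0"
  shows "lap_conv b y \<le> ennreal (exp (2 * V)) * exp_conv (y + V) + ennreal (exp (- (b / 2 * V))) * lap_conv (b / 2) y"
proof -
  have "lap_conv b y \<le> (\<integral>\<^sup>+x. ennreal (exp (2 * V)) * (ennreal (exp (x - (y + V))) * indicator {..<y + V} x)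
      + ennreal (exp (- (b / 2 * V))) * ennreal (lap (b / 2) (y - x)) \<partial>\<mu>)"
    unfolding lap_conv_def
  proof (rule nn_integral_mono)
    fix x
    show "ennreal (lap b (y - x)) \<le> ennreal (exp (2 * V)) * (ennreal (exp (x - (y + V))) * indicator {..<y + V} x)
      + ennreal (exp (- (b / 2 * V))) * ennreal (lap (b / 2) (y - x))" (is "?l \<le> ?r1 + ?r2")
    proof (cases "\<bar>y - x\<bar> < V")
      case True
      have "lap b (y - x) \<le> 1"
        using assms by (simp add: lap_def)
      also have "\<dots> \<le> exp (2 * V) * exp (x - (y + V))"
        using True by (simp flip: exp_add)
      finally have "?l \<le> ennreal (exp (2 * V) * exp (x - (y + V)))"
        by (rule ennreal_leI)
      also have "\<dots> = ?r1"
        using True by (simp add: ennreal_mult)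
      finally show ?thesis
        by (rule order_trans) simp
    next
      case False
      then have "b / 2 * V \<le> b / 2 * \<bar>y - x\<bar>"
        using assms by (intro mult_left_mono) auto
      then have "lap b (y - x) \<le> exp (- (b / 2 * V)) * lap (b / 2) (y - x)"
        by (simp add: lap_def flip: exp_add)
      then have "?l \<le> ?r2"
        by (simp add: ennreal_leI flip: ennreal_mult)
      then show ?thesis
        by (rule order_trans) simp
    qed
  qed
  also have "\<dots> = ennreal (exp (2 * V)) * exp_conv (y + V) + ennreal (exp (- (b / 2 * V))) * lap_conv (b / 2) y"
    unfolding exp_conv_def lap_conv_def by (subst nn_integral_add) (simp_all add: nn_integral_cmult)
  finally show ?thesis .
qed

theorem exp_conv_bounds: "\<exists>c>0. \<exists>C t0. \<forall>t\<ge>t0. ennreal c \<le> exp_conv t \<and> exp_conv t \<le> ennreal C"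
proof -
  \<comment> \<open>\<open>b \<le> 1\<close> allows the comparison with the one-sided kernel; the
    quotient ensures both smallness conditions of \<open>lap_conv_lower\<close>.\<close>
  define b where "b = min 1 (a / (8 * B + 8 * err_norm + 1))"
  have den: "8 * B + 8 * err_norm + 1 > 0"
    using B_nonneg err_norm_nonneg by linarith
  have b: "b > 0" "b \<le> 1"
    using a_pos den by (auto simp: b_def)
  have "b * (8 * B + 8 * err_norm + 1) \<le> a"
    using den by (subst pos_le_divide_eq[symmetric]) (simp_all add: b_def)
  moreover have "b * B \<ge> 0" "b * err_norm \<ge> 0"
    using b B_nonneg err_norm_nonneg by simp_all
  ultimately have be: "b * err_norm \<le> a / 2" "2 * b * (4 * B + 4 * err_norm) \<le> a"
    using b by (simp_all add: algebra_simps)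
  define R where "R = 4 / (b / 2) + 4 * B / a"
  have "R > 0"
    using b a_pos B_nonneg by (simp add: R_def add_pos_nonneg)
  have R: "lap_conv (b / 2) y \<le> ennreal R" for y
    unfolding R_def using b be \<open>b * err_norm \<ge> 0\<close> by (intro lap_conv_upper) auto
  \<comment> \<open>Chosen so that the far part costs at most \<open>1 / (4 * b)\<close>, half of
    the lower bound \<open>1 / (2 * b)\<close> for \<open>lap_conv\<close>.\<close>
  define V where "V = 2 / b * ln (4 * b * R + 1)"
  have "V > 0"
    unfolding V_def using b \<open>R > 0\<close> by (intro mult_pos_pos ln_gt_zero) auto
  have "exp (- (b / 2 * V)) = 1 / (4 * b * R + 1)"
    using b \<open>R > 0\<close> by (simp add: V_def exp_minus inverse_eq_divide add_pos_pos)
  then have "exp (- (b / 2 * V)) * R = R / (4 * b * R + 1)"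
    by simp
  also have "\<dots> \<le> R / (4 * b * R)"
    using b \<open>R > 0\<close> by (intro divide_left_mono mult_pos_pos add_pos_pos) auto
  also have "\<dots> = 1 / (4 * b)"
    using \<open>R > 0\<close> by simp
  finally have tail: "exp (- (b / 2 * V)) * R \<le> 1 / (4 * b)" .
  define c where "c = exp (- (2 * V)) / (4 * b)"
  have "c > 0"
    using b by (simp add: c_def)
  have lower: "ennreal c \<le> exp_conv t" if "t \<ge> V" for t
  proof (cases "exp_conv t")
    case (real s)
    have "ennreal (1 / (2 * b)) \<le> lap_conv b (t - V)"
      using that by (intro lap_conv_lower b be) auto
    also have "\<dots> \<le> ennreal (exp (2 * V)) * exp_conv (t - V + V) + ennreal (exp (- (b / 2 * V))) * lap_conv (b / 2) (t - V)"
      by (rule lap_conv_le_exp_conv[OF b(1) \<open>V > 0\<close>])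
    also have "\<dots> \<le> ennreal (exp (2 * V)) * ennreal s + ennreal (exp (- (b / 2 * V))) * ennreal R"
      using real by (intro add_mono mult_left_mono R) auto
    also have "\<dots> = ennreal (exp (2 * V) * s + exp (- (b / 2 * V)) * R)"
      using real \<open>R > 0\<close> by (simp add: ennreal_plus ennreal_mult)
    finally have "1 / (2 * b) \<le> exp (2 * V) * s + exp (- (b / 2 * V)) * R"
      using real \<open>R > 0\<close> by (subst (asm) ennreal_le_iff) auto
    with tail have "1 / (2 * b) - 1 / (4 * b) \<le> exp (2 * V) * s"
      by linarith
    then have "1 / (4 * b) \<le> exp (2 * V) * s"
      by (simp add: field_simps)
    then have "c \<le> s"
      unfolding c_def using b by (simp add: exp_minus field_simps)
    then show ?thesis
      using real by (simp add: ennreal_leI)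
  qed simp
  have "exp_conv t \<le> ennreal (4 / b + 4 * B / a)" for t
    using exp_conv_le_lap_conv[OF b] lap_conv_upper[OF b(1) be(1)] by (rule order_trans)
  with lower \<open>c > 0\<close> show ?thesis
    by blast
qed

end

section \<open>Generalized integers\<close>

definition gen_ints :: "(nat \<Rightarrow> real) \<Rightarrow> real \<Rightarrow> (nat \<Rightarrow> nat) set" where
  "gen_ints p x = {\<alpha>. finite {k. \<alpha> k \<noteq> 0} \<and> gen_int p \<alpha> < x}"

definition prime_pows :: "(nat \<Rightarrow> real) \<Rightarrow> real \<Rightarrow> (nat \<times> nat) set" where
  "prime_pows p x = {(k, j). j \<ge> 1 \<and> p k ^ j < x}"

lemma gen_int_superset:
  assumes "finite K" "{k. \<alpha> k \<noteq> 0} \<subseteq> K"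
  shows "gen_int p \<alpha> = (\<Prod>k\<in>K. p k ^ \<alpha> k)"
  unfolding gen_int_def by (rule prod.mono_neutral_left) (use assms in auto)

lemma gen_int_upd_add:
  assumes "finite {k. \<alpha> k \<noteq> 0}"
  shows "gen_int p (\<alpha>(k := \<alpha> k + j)) = gen_int p \<alpha> * p k ^ j"
proof -
  let ?K = "insert k {k. \<alpha> k \<noteq> 0}"
  have "gen_int p (\<alpha>(k := \<alpha> k + j)) = (\<Prod>i\<in>?K. p i ^ (\<alpha>(k := \<alpha> k + j)) i)"
    by (rule gen_int_superset) (use assms in auto)
  also have "\<dots> = p k ^ (\<alpha> k + j) * (\<Prod>i\<in>?K - {k}. p i ^ \<alpha> i)"
    using assms by (subst prod.remove[of _ k]) (auto intro!: prod.cong)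
  also have "\<dots> = p k ^ j * (\<Prod>i\<in>?K. p i ^ \<alpha> i)"
    using assms by (subst (2) prod.remove[of _ k]) (auto simp: power_add)
  also have "(\<Prod>i\<in>?K. p i ^ \<alpha> i) = gen_int p \<alpha>"
    by (rule gen_int_superset[symmetric]) (use assms in auto)
  finally show ?thesis by (simp only: mult.commute)
qed

text \<open>For positive \<open>t\<close> the number of naturals below \<open>t\<close> is its
  ceiling. This discrete layer-cake bound later turns a sum of logarithms into a sum of
  counts.\<close>

lemma le_card_less:
  fixes t :: real
  assumes "t \<le> real M"
  shows "t \<le> (\<Sum>i<M. if real i < t then 1 else 0)"
proof -
  have "{..<nat \<lceil>t\<rceil>} \<subseteq> {i\<in>{..<M}. real i < t}"
    using assms by (auto simp: ceiling_le_iff zless_nat_eq_int_zless less_ceiling_iff; linarith)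
  then have "card {..<nat \<lceil>t\<rceil>} \<le> card {i\<in>{..<M}. real i < t}"
    by (intro card_mono) auto
  then have "nat \<lceil>t\<rceil> \<le> card {i\<in>{..<M}. real i < t}"
    by simp
  moreover have "t \<le> real (nat \<lceil>t\<rceil>)"
    by (rule real_nat_ceiling_ge)
  ultimately have "t \<le> real (card {i\<in>{..<M}. real i < t})"
    by linarith
  also have "\<dots> = (\<Sum>i<M. if real i < t then 1 else 0)"
    by (subst sum.inter_filter[symmetric]) auto
  finally show ?thesis .
qed

locale beurling =
  fixes p :: "nat \<Rightarrow> real"
  assumes primes: "beurling_primes p"
begin

abbreviation "N \<equiv> beurling_N p"

lemma p_gt_1: "p k > 1"
proof -
  have "p 0 \<le> p k"
    using primes by (auto simp: beurling_primes_def mono_def)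
  then show ?thesis
    using primes by (auto simp: beurling_primes_def)
qed

lemma p_pos: "p k > 0"
  using p_gt_1[of k] by linarith

lemma ln_p_pos: "ln (p k) > 0"
  using p_gt_1[of k] by simp

section \<open>Finiteness of the index sets\<close>

lemma finite_primes_less: "finite {k. p k < x}"
proof -
  have "\<forall>\<^sub>F k in sequentially. x \<le> p k"
    using primes by (auto simp: beurling_primes_def filterlim_at_top)
  then obtain K where "\<And>k. k \<ge> K \<Longrightarrow> x \<le> p k"
    by (auto simp: eventually_sequentially)
  then have "{k. p k < x} \<subseteq> {..<K}"
    by (auto simp: not_less[symmetric])
  then show ?thesis
    by (rule finite_subset) simp
qed

lemma power_le_gen_int:
  assumes "finite {k. \<alpha> k \<noteq> 0}"
  shows "p k ^ \<alpha> k \<le> gen_int p \<alpha>"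
proof -
  let ?K = "insert k {k. \<alpha> k \<noteq> 0}"
  have "gen_int p \<alpha> = p k ^ \<alpha> k * (\<Prod>i\<in>?K - {k}. p i ^ \<alpha> i)"
    using assms by (subst gen_int_superset[of ?K]) (auto simp: prod.remove[of _ k])
  moreover have "(\<Prod>i\<in>?K - {k}. p i ^ \<alpha> i) \<ge> 1"
    by (intro prod_ge_1 one_le_power less_imp_le p_gt_1)
  ultimately show ?thesis
    using mult_left_mono[of 1 _ "p k ^ \<alpha> k"] p_gt_1[of k] by simp
qed

lemma gen_int_ge_1: "gen_int p \<alpha> \<ge> 1"
  unfolding gen_int_def by (intro prod_ge_1 one_le_power less_imp_le p_gt_1)

text \<open>\<open>p 0\<close> is the least prime, so one of its powers exceeding \<open>x\<close>
  bounds the exponents of all primes at once.\<close>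

lemma power_bound:
  obtains M where "\<And>k j. p k ^ j < x \<Longrightarrow> j < M"
proof -
  obtain M where M: "x < p 0 ^ M"
    using real_arch_pow[OF p_gt_1] by blast
  have "j < M" if "p k ^ j < x" for k j
  proof (rule ccontr)
    assume "\<not> j < M"
    then have "p 0 ^ M \<le> p 0 ^ j"
      using p_gt_1[of 0] by (intro power_increasing) auto
    also have "\<dots> \<le> p k ^ j"
      using primes p_gt_1[of 0] by (intro power_mono) (auto simp: beurling_primes_def mono_def)
    finally show False using M that by linarith
  qed
  then show ?thesis by (rule that)
qed

text \<open>The exponent vectors in question are supported on the finitely many primes below
  \<open>x\<close> and have uniformly bounded entries.\<close>

lemma finite_gen_ints: "finite (gen_ints p x)"
proof -
  obtain M where M: "\<And>k j. p k ^ j < x \<Longrightarrow> j < M"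
    by (rule power_bound[of x]) blast
  have "gen_ints p x \<subseteq> {\<alpha>. \<forall>k. (k \<in> {k. p k < x} \<longrightarrow> \<alpha> k \<in> {..<M}) \<and> (k \<notin> {k. p k < x} \<longrightarrow> \<alpha> k = 0)}"
  proof (intro subsetI CollectI allI conjI impI)
    fix \<alpha> k assume \<alpha>: "\<alpha> \<in> gen_ints p x"
    then have less: "p k ^ \<alpha> k < x"
      using power_le_gen_int[of \<alpha> k] by (auto simp: gen_ints_def)
    then show "\<alpha> k \<in> {..<M}" using M by simp
    assume "k \<notin> {k. p k < x}"
    then have "x \<le> p k" by simp
    show "\<alpha> k = 0"
    proof (rule ccontr)
      assume "\<alpha> k \<noteq> 0"
      then have "p k \<le> p k ^ \<alpha> k" using p_gt_1[of k] by (intro self_le_power) auto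
      then show False using less \<open>x \<le> p k\<close> by linarith
    qed
  qed
  then show ?thesis
    by (rule finite_subset) (intro finite_set_of_finite_funs finite_primes_less finite_lessThan)
qed

lemma finite_prime_pows: "finite (prime_pows p x)"
proof -
  obtain M where M: "\<And>k j. p k ^ j < x \<Longrightarrow> j < M"
    by (rule power_bound[of x]) blast
  have "prime_pows p x \<subseteq> {k. p k < x} \<times> {..<M}"
  proof
    fix i assume "i \<in> prime_pows p x"
    then obtain k j where i: "i = (k, j)" and j: "j \<ge> 1" "p k ^ j < x" by (auto simp: prime_pows_def)
    have "p k \<le> p k ^ j" using p_gt_1[of k] j by (intro self_le_power) auto
    then show "i \<in> {k. p k < x} \<times> {..<M}" using j M unfolding i by auto
  qed
  then show ?thesis
    by (rule finite_subset) (simp add: finite_primes_less)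
qed

section \<open>The counting function and sums of logarithms\<close>

lemma N_eq: "N x = real (card (gen_ints p x))"
  by (simp add: beurling_N_def gen_ints_def)

lemma N_mono: "x \<le> y \<Longrightarrow> N x \<le> N y"
  unfolding N_eq by (intro of_nat_mono card_mono finite_gen_ints) (auto simp: gen_ints_def)

lemma N_nonneg: "N x \<ge> 0"
  by (simp add: N_eq)

lemma gen_ints_empty: "x \<le> 1 \<Longrightarrow> gen_ints p x = {}"
  by (auto simp: gen_ints_def not_less intro: order_trans[OF _ gen_int_ge_1])

lemma N_ge_1:
  assumes "x > 1"
  shows "N x \<ge> 1"
proof -
  have "(\<lambda>_. 0) \<in> gen_ints p x"
    using assms by (simp add: gen_ints_def gen_int_def)
  then have "card (gen_ints p x) > 0"
    using finite_gen_ints by (auto simp: card_gt_0_iff)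
  then show ?thesis
    by (simp add: N_eq)
qed

text \<open>Multiplication by \<open>p k ^ j\<close>, which adds \<open>j\<close> to the exponent at
  \<open>k\<close>, is a bijection onto the integers divisible by \<open>p k ^ j\<close>.\<close>

lemma card_gen_ints_divisible:
  "card {\<alpha> \<in> gen_ints p x. j \<le> \<alpha> k} = card (gen_ints p (x / p k ^ j))"
proof (rule bij_betw_same_card[symmetric],
    rule bij_betw_byWitness[where f="\<lambda>\<alpha>. \<alpha>(k := \<alpha> k + j)" and f'="\<lambda>\<alpha>. \<alpha>(k := \<alpha> k - j)"])
  let ?f = "\<lambda>\<alpha>. \<alpha>(k := \<alpha> k + j)" and ?g = "\<lambda>\<alpha>. \<alpha>(k := \<alpha> k - j)"
  have pos: "p k ^ j > 0" using p_gt_1[of k] by simp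
  have supp: "finite {i. (\<alpha>(k := v)) i \<noteq> 0}" if "finite {i. \<alpha> i \<noteq> 0}" for \<alpha> :: "nat \<Rightarrow> nat" and v
    by (rule finite_subset[of _ "insert k {i. \<alpha> i \<noteq> 0}"]) (use that in auto)
  show "\<forall>\<alpha>\<in>gen_ints p (x / p k ^ j). ?g (?f \<alpha>) = \<alpha>"
    by simp
  show "\<forall>\<alpha>\<in>{\<alpha> \<in> gen_ints p x. j \<le> \<alpha> k}. ?f (?g \<alpha>) = \<alpha>"
    by (intro ballI) simp
  show "?f ` gen_ints p (x / p k ^ j) \<subseteq> {\<alpha> \<in> gen_ints p x. j \<le> \<alpha> k}"
  proof (rule image_subsetI)
    fix \<alpha> assume "\<alpha> \<in> gen_ints p (x / p k ^ j)"
    then have fin: "finite {i. \<alpha> i \<noteq> 0}" and less: "gen_int p \<alpha> < x / p k ^ j"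
      by (simp_all add: gen_ints_def)
    have "gen_int p (?f \<alpha>) < x"
      unfolding gen_int_upd_add[OF fin] using less pos by (simp add: pos_less_divide_eq)
    then show "?f \<alpha> \<in> {\<alpha> \<in> gen_ints p x. j \<le> \<alpha> k}"
      using supp[OF fin, of "\<alpha> k + j"] unfolding gen_ints_def by simp
  qed
  show "?g ` {\<alpha> \<in> gen_ints p x. j \<le> \<alpha> k} \<subseteq> gen_ints p (x / p k ^ j)"
  proof (rule image_subsetI)
    fix \<alpha> assume "\<alpha> \<in> {\<alpha> \<in> gen_ints p x. j \<le> \<alpha> k}"
    then have fin: "finite {i. \<alpha> i \<noteq> 0}" and less: "gen_int p \<alpha> < x" and "j \<le> \<alpha> k"
      by (simp_all add: gen_ints_def)
    have fin': "finite {i. ?g \<alpha> i \<noteq> 0}" by (rule supp[OF fin])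
    have "gen_int p (?g \<alpha>) * p k ^ j = gen_int p (?f (?g \<alpha>))"
      by (rule gen_int_upd_add[OF fin', symmetric])
    also have "?f (?g \<alpha>) = \<alpha>"
      using \<open>j \<le> \<alpha> k\<close> by simp
    finally have eq: "gen_int p (?g \<alpha>) * p k ^ j = gen_int p \<alpha>" .
    have "gen_int p (?g \<alpha>) * p k ^ j < x"
      unfolding eq by (rule less)
    then have "gen_int p (?g \<alpha>) < x / p k ^ j"
      using pos by (simp add: pos_less_divide_eq)
    with fin' show "?g \<alpha> \<in> gen_ints p (x / p k ^ j)"
      unfolding gen_ints_def by blast
  qed
qed

text \<open>This is log n as the sum of \<Lambda>(d) over the divisors d of n. The cutoff in
  \<open>prime_pows p x\<close> loses nothing, because prime powers dividing an integer below
  \<open>x\<close> are themselves below \<open>x\<close>.\<close>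

lemma ln_gen_int:
  assumes "\<alpha> \<in> gen_ints p x"
  shows "ln (gen_int p \<alpha>) = (\<Sum>(k, j)\<in>prime_pows p x. if j \<le> \<alpha> k then ln (p k) else 0)"
proof -
  let ?A = "{k. \<alpha> k \<noteq> 0}"
  have fin: "finite ?A" and less: "gen_int p \<alpha> < x"
    using assms by (auto simp: gen_ints_def)
  have "ln (gen_int p \<alpha>) = (\<Sum>k\<in>?A. ln (p k ^ \<alpha> k))"
    unfolding gen_int_def using fin p_pos by (intro ln_prod) (auto simp: less_imp_neq[symmetric])
  also have "\<dots> = (\<Sum>k\<in>?A. \<Sum>j\<in>{1..\<alpha> k}. ln (p k))"
    using p_pos by (intro sum.cong refl) (simp add: ln_realpow)
  also have "\<dots> = (\<Sum>(k, j)\<in>(SIGMA k:?A. {1..\<alpha> k}). ln (p k))"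
    using fin by (subst sum.Sigma) auto
  also have "(SIGMA k:?A. {1..\<alpha> k}) = {i \<in> prime_pows p x. snd i \<le> \<alpha> (fst i)}"
  proof -
    have "p k ^ j < x" if "j \<le> \<alpha> k" for k j
    proof -
      have "p k ^ j \<le> p k ^ \<alpha> k" using that p_gt_1[of k] by (intro power_increasing) auto
      then show ?thesis using power_le_gen_int[OF fin, of k] less by linarith
    qed
    then show ?thesis by (auto simp: prime_pows_def)
  qed
  also have "(\<Sum>(k, j)\<in>{i \<in> prime_pows p x. snd i \<le> \<alpha> (fst i)}. ln (p k))
      = (\<Sum>(k, j)\<in>prime_pows p x. if j \<le> \<alpha> k then ln (p k) else 0)"
    by (subst sum.inter_filter[OF finite_prime_pows]) (auto intro!: sum.cong)
  finally show ?thesis .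
qed

text \<open>The identity \<open>log \<cdot> dN = dN * d\<psi>\<close>.\<close>

lemma sum_ln_gen_int:
  "(\<Sum>\<alpha>\<in>gen_ints p x. ln (gen_int p \<alpha>)) = (\<Sum>(k, j)\<in>prime_pows p x. ln (p k) * N (x / p k ^ j))"
proof -
  have "(\<Sum>\<alpha>\<in>gen_ints p x. ln (gen_int p \<alpha>))
      = (\<Sum>\<alpha>\<in>gen_ints p x. \<Sum>i\<in>prime_pows p x. if snd i \<le> \<alpha> (fst i) then ln (p (fst i)) else 0)"
    by (intro sum.cong refl) (simp add: ln_gen_int case_prod_unfold)
  also have "\<dots> = (\<Sum>i\<in>prime_pows p x. \<Sum>\<alpha>\<in>gen_ints p x. if snd i \<le> \<alpha> (fst i) then ln (p (fst i)) else 0)"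
    by (rule sum.swap)
  also have "\<dots> = (\<Sum>i\<in>prime_pows p x. ln (p (fst i)) * N (x / p (fst i) ^ snd i))"
    by (intro sum.cong refl)
       (simp add: sum.inter_filter[OF finite_gen_ints, symmetric] N_eq card_gen_ints_divisible)
  finally show ?thesis
    by (simp add: case_prod_unfold)
qed

text \<open>The sum equals the integral of N(t)/t over [1,x]. Here each logarithm is bounded by the
  number of naturals \<open>i\<close> below it; exchanging the sums leaves counts at most
  \<open>N (x * exp (- real i))\<close>, and rounding the ratio \<open>exp (- 1)\<close> up to 1/2
  gives a geometric series of sum at most 2.\<close>

lemma sum_ln_quotient_le:
  assumes C: "\<And>x. x > 0 \<Longrightarrow> N x \<le> C * x" and "x > 0"
  shows "(\<Sum>\<alpha>\<in>gen_ints p x. ln (x / gen_int p \<alpha>)) \<le> 2 * C * x"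
proof -
  obtain M :: nat where M: "ln x \<le> real M"
    using real_arch_simple by blast
  have "C \<ge> 0"
    using C[of 1] N_nonneg[of 1] by linarith
  have pos: "gen_int p \<alpha> > 0" for \<alpha>
    using gen_int_ge_1[of \<alpha>] by linarith
  have "(\<Sum>\<alpha>\<in>gen_ints p x. ln (x / gen_int p \<alpha>))
    \<le> (\<Sum>\<alpha>\<in>gen_ints p x. \<Sum>i<M. if real i < ln (x / gen_int p \<alpha>) then 1 else 0)"
  proof (intro sum_mono le_card_less)
    fix \<alpha>
    have "ln (x / gen_int p \<alpha>) \<le> ln x"
      using gen_int_ge_1[of \<alpha>] \<open>x > 0\<close> by (simp add: ln_div pos)
    then show "ln (x / gen_int p \<alpha>) \<le> real M" using M by linarith
  qed
  also have "\<dots> = (\<Sum>i<M. \<Sum>\<alpha>\<in>gen_ints p x. if real i < ln (x / gen_int p \<alpha>) then 1 else 0)"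
    by (rule sum.swap)
  also have "\<dots> \<le> (\<Sum>i<M. C * x * (1 / 2) ^ i)"
  proof (rule sum_mono)
    fix i
    have "real i < ln (x / gen_int p \<alpha>) \<longleftrightarrow> gen_int p \<alpha> < x * exp (- real i)" for \<alpha>
    proof -
      have "real i < ln (x / gen_int p \<alpha>) \<longleftrightarrow> exp (real i) < x / gen_int p \<alpha>"
        using \<open>x > 0\<close> pos by (metis divide_pos_pos exp_less_cancel_iff exp_ln)
      also have "\<dots> \<longleftrightarrow> gen_int p \<alpha> < x * exp (- real i)"
        using pos[of \<alpha>] by (simp add: exp_minus field_simps)
      finally show ?thesis .
    qed
    then have "{\<alpha> \<in> gen_ints p x. real i < ln (x / gen_int p \<alpha>)} \<subseteq> gen_ints p (x * exp (- real i))"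
      by (auto simp: gen_ints_def)
    then have "card {\<alpha> \<in> gen_ints p x. real i < ln (x / gen_int p \<alpha>)} \<le> card (gen_ints p (x * exp (- real i)))"
      by (intro card_mono finite_gen_ints)
    then have "(\<Sum>\<alpha>\<in>gen_ints p x. if real i < ln (x / gen_int p \<alpha>) then 1 else 0) \<le> N (x * exp (- real i))"
      by (simp add: sum.inter_filter[OF finite_gen_ints, symmetric] N_eq)
    also have "\<dots> \<le> C * (x * exp (- real i))"
      using \<open>x > 0\<close> by (intro C) simp
    also have "exp (- real i) \<le> (1 / 2) ^ i"
    proof -
      have "exp (- 1) \<le> (1 / 2 :: real)"
        using exp_ge_add_one_self[of "1::real"] by (simp add: exp_minus field_simps)
      then have "exp (- 1) ^ i \<le> (1 / 2 :: real) ^ i"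
        by (intro power_mono) auto
      then show ?thesis
        by (simp add: exp_of_nat_mult[symmetric])
    qed
    finally show "(\<Sum>\<alpha>\<in>gen_ints p x. if real i < ln (x / gen_int p \<alpha>) then 1 else 0) \<le> C * x * (1 / 2) ^ i"
      using \<open>C \<ge> 0\<close> \<open>x > 0\<close> by (simp add: mult_left_mono mult.assoc)
  qed
  also have "\<dots> = C * x * (\<Sum>i<M. (1 / 2) ^ i)"
    by (simp add: sum_distrib_left)
  also have "\<dots> \<le> C * x * 2"
  proof (rule mult_left_mono)
    show "(\<Sum>i<M. (1 / 2 :: real) ^ i) \<le> 2"
      by (subst geometric_sum) (auto simp: field_simps)
  qed (use \<open>C \<ge> 0\<close> \<open>x > 0\<close> in simp)
  finally show ?thesis
    by (simp add: mult.commute mult.left_commute)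
qed

end

section \<open>The renewal measure of a Beurling system\<close>

locale beurling_approx = beurling +
  fixes a :: real
  assumes a_pos: "a > 0"
    and error_integrable: "(\<lambda>x. \<bar>(beurling_N p x - a * x) / x\<bar> / x) integrable_on {1..}"
    and error_small: "(\<lambda>x. beurling_N p x - a * x) \<in> o[at_top](\<lambda>x. x / ln x)"
begin

text \<open>From some \<open>X\<close> on, the little-o hypothesis gives the constant 1. On the
  remaining bounded range, \<open>N\<close> and \<open>ln\<close> are monotone and
  \<open>x > 1\<close>, so their values at \<open>Y\<close> give a constant.\<close>

lemma error_bound: "\<exists>B\<ge>0. \<forall>x>1. \<bar>N x - a * x\<bar> * ln x \<le> B * x"
proof -
  have "\<forall>\<^sub>F x in at_top. norm (N x - a * x) \<le> 1 * norm (x / ln x)"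
    using landau_o.smallD[OF error_small, of 1] by simp
  then obtain X where X: "\<And>x. x \<ge> X \<Longrightarrow> \<bar>N x - a * x\<bar> \<le> \<bar>x / ln x\<bar>"
    by (auto simp: eventually_at_top_linorder)
  define Y where "Y = max X 2"
  define B where "B = max 1 ((N Y + a * Y) * ln Y)"
  have "\<bar>N x - a * x\<bar> * ln x \<le> B * x" if "x > 1" for x
  proof (cases "x \<ge> Y")
    case True
    then have "\<bar>N x - a * x\<bar> * ln x \<le> \<bar>x / ln x\<bar> * ln x"
      using that by (intro mult_right_mono X) (auto simp: Y_def)
    also have "\<dots> = 1 * x"
      using that by simp
    also have "\<dots> \<le> B * x"
      using that by (intro mult_right_mono) (auto simp: B_def)
    finally show ?thesis .
  next
    case False
    then have "\<bar>N x - a * x\<bar> \<le> N Y + a * Y"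
    proof -
      have "N x \<le> N Y" "a * x \<le> a * Y" "N x \<ge> 0" "a * x \<ge> 0"
        using False a_pos that N_nonneg by (auto intro!: N_mono mult_left_mono)
      then show ?thesis by linarith
    qed
    then have "\<bar>N x - a * x\<bar> * ln x \<le> (N Y + a * Y) * ln Y"
      using False that a_pos N_nonneg[of Y] by (intro mult_mono) (auto simp: Y_def)
    also have "\<dots> \<le> B * 1"
      by (simp add: B_def)
    also have "\<dots> \<le> B * x"
      using that by (intro mult_left_mono) (auto simp: B_def)
    finally show ?thesis .
  qed
  then show ?thesis
    by (intro exI[of _ B]) (auto simp: B_def)
qed

section \<open>The functions \<open>F\<close> and \<open>G\<close> in the logarithmic
  variable\<close>

definition F :: "real \<Rightarrow> real" where
  "F z = (if z > 0 then N (exp z) * exp (- z) else 0)"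

lemma F_measurable [measurable]: "F \<in> borel_measurable borel"
proof -
  have [measurable]: "(\<lambda>z. N (exp z)) \<in> borel_measurable borel"
    by (intro borel_measurable_mono monoI N_mono) simp
  show ?thesis
    unfolding F_def by measurable
qed

lemma F_approx: "\<exists>B\<ge>0. \<forall>z>0. \<bar>F z - a\<bar> * z \<le> B"
proof -
  obtain B where B: "B \<ge> 0" "\<And>x. x > 1 \<Longrightarrow> \<bar>N x - a * x\<bar> * ln x \<le> B * x"
    using error_bound by auto
  have "\<bar>F z - a\<bar> * z \<le> B" if "z > 0" for z
  proof -
    have "F z - a = (N (exp z) - a * exp z) * exp (- z)"
      using that by (simp add: F_def algebra_simps flip: exp_add)
    then have "\<bar>F z - a\<bar> * z = \<bar>N (exp z) - a * exp z\<bar> * ln (exp z) * exp (- z)"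
      by (simp add: abs_mult)
    also have "\<dots> \<le> B * exp z * exp (- z)"
      using that by (intro mult_right_mono B) auto
    finally show ?thesis
      by (simp add: mult.assoc flip: exp_add)
  qed
  with B(1) show ?thesis by blast
qed

text \<open>Beyond \<open>z0\<close> the approximation keeps \<open>F z\<close> within
  \<open>a / 2\<close> of \<open>a\<close>; up to \<open>z0\<close> the integer 1 is counted, whence
  \<open>F z \<ge> exp (- z)\<close>.\<close>

lemma F_lower: "\<exists>m>0. \<forall>z>0. m \<le> F z"
proof -
  obtain B where B: "B \<ge> 0" "\<And>z. z > 0 \<Longrightarrow> \<bar>F z - a\<bar> * z \<le> B"
    using F_approx by auto
  define z0 where "z0 = 2 * B / a"
  have "min (a / 2) (exp (- z0)) \<le> F z" if "z > 0" for z
  proof (cases "z \<le> z0")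
    case True
    have "exp (- z0) \<le> 1 * exp (- z)"
      using True by simp
    also have "\<dots> \<le> N (exp z) * exp (- z)"
      using that by (intro mult_right_mono N_ge_1) auto
    finally show ?thesis
      using that by (simp add: F_def)
  next
    case False
    have "\<bar>F z - a\<bar> * z \<le> a / 2 * z0"
      using B(2)[OF that] a_pos by (simp add: z0_def)
    also have "\<dots> \<le> a / 2 * z"
      using False a_pos by (intro mult_left_mono) auto
    finally have "\<bar>F z - a\<bar> \<le> a / 2"
      using that by simp
    then show ?thesis by linarith
  qed
  then show ?thesis
    using a_pos by (intro exI[of _ "min (a / 2) (exp (- z0))"]) auto
qed

text \<open>The bound extends down to 0 because \<open>sum_ln_quotient_le\<close> evaluates
  \<open>N\<close> at arbitrarily small positive arguments.\<close>

lemma N_linear: "\<exists>C. \<forall>x>0. N x \<le> C * x"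
proof -
  obtain B where B: "B \<ge> 0" "\<And>x. x > 1 \<Longrightarrow> \<bar>N x - a * x\<bar> * ln x \<le> B * x"
    using error_bound by auto
  have large: "N x \<le> (a + B) * x" if "x \<ge> exp 1" for x
  proof -
    have "x > 1"
      using that exp_gt_one[of "1::real"] by linarith
    moreover have "ln x \<ge> 1"
      using that \<open>x > 1\<close> by (simp add: ln_ge_iff)
    ultimately have "\<bar>N x - a * x\<bar> * 1 \<le> \<bar>N x - a * x\<bar> * ln x"
      by (intro mult_left_mono) auto
    also have "\<dots> \<le> B * x"
      using \<open>x > 1\<close> by (rule B)
    finally show ?thesis
      by (simp add: algebra_simps)
  qed
  have "N x \<le> (a + B) * exp 1 * x" if "x > 0" for x
  proof -
    consider "x \<le> 1" | "1 < x" "x \<le> exp 1" | "x \<ge> exp 1"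
      by linarith
    then show ?thesis
    proof cases
      case 1
      then show ?thesis
        using that a_pos B(1) by (simp add: N_eq gen_ints_empty)
    next
      case 2
      have "N x \<le> N (exp 1)"
        using 2 by (intro N_mono)
      also have "\<dots> \<le> (a + B) * exp 1 * 1"
        using large[of "exp 1"] by simp
      also have "\<dots> \<le> (a + B) * exp 1 * x"
        using 2 a_pos B(1) by (intro mult_left_mono) auto
      finally show ?thesis .
    next
      case 3
      have "N x \<le> (a + B) * 1 * x"
        using large[OF 3] by simp
      also have "\<dots> \<le> (a + B) * exp 1 * x"
        using that a_pos B(1) by (intro mult_right_mono mult_left_mono) auto
      finally show ?thesis .
    qed
  qed
  then show ?thesis by blast
qed

definition G :: "real \<Rightarrow> real" where
  "G u = exp (- u) * (\<Sum>\<alpha>\<in>gen_ints p (exp u). ln (gen_int p \<alpha>))"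

text \<open>Writing log n as u - log(e^u/n) turns the sum into \<open>u * N (exp u)\<close> minus a
  sum of order \<open>exp u\<close>, by \<open>sum_ln_quotient_le\<close>. After division by
  \<open>exp u\<close> the first term is \<open>u * F u\<close>, which is a u + O(1).\<close>

lemma G_approx: "\<exists>B. \<forall>u. \<bar>G u - a * max 0 u\<bar> \<le> B"
proof -
  obtain B where B: "B \<ge> 0" "\<And>z. z > 0 \<Longrightarrow> \<bar>F z - a\<bar> * z \<le> B"
    using F_approx by auto
  obtain C where C: "\<And>x. x > 0 \<Longrightarrow> N x \<le> C * x"
    using N_linear by blast
  have "C \<ge> 0"
    using C[of 1] N_nonneg[of 1] by linarith
  have "\<bar>G u - a * max 0 u\<bar> \<le> B + 2 * C" for u
  proof (cases "u > 0")
    case False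
    then show ?thesis
      using B(1) \<open>C \<ge> 0\<close> by (simp add: G_def gen_ints_empty)
  next
    case True
    define D where "D = (\<Sum>\<alpha>\<in>gen_ints p (exp u). ln (exp u / gen_int p \<alpha>))"
    have pos: "gen_int p \<alpha> > 0" for \<alpha>
      using gen_int_ge_1[of \<alpha>] by linarith
    have "D \<ge> 0"
      unfolding D_def by (intro sum_nonneg ln_ge_zero) (auto simp: gen_ints_def pos)
    have "D \<le> 2 * C * exp u"
      unfolding D_def by (intro sum_ln_quotient_le C) auto
    then have D: "exp (- u) * D \<le> 2 * C" "exp (- u) * D \<ge> 0"
      using \<open>D \<ge> 0\<close> by (simp_all add: exp_minus field_simps)
    have "D = (\<Sum>\<alpha>\<in>gen_ints p (exp u). u - ln (gen_int p \<alpha>))"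
      unfolding D_def using pos by (intro sum.cong refl) (simp add: ln_div less_imp_neq[symmetric])
    also have "\<dots> = u * N (exp u) - (\<Sum>\<alpha>\<in>gen_ints p (exp u). ln (gen_int p \<alpha>))"
      by (simp add: sum_subtractf N_eq)
    finally have "(\<Sum>\<alpha>\<in>gen_ints p (exp u). ln (gen_int p \<alpha>)) = u * N (exp u) - D"
      by simp
    then have "G u = u * F u - exp (- u) * D"
      using True by (simp add: G_def F_def right_diff_distrib mult.commute mult.left_commute)
    then have "G u - a * max 0 u = (F u - a) * u - exp (- u) * D"
      using True by (simp add: algebra_simps)
    moreover have "\<bar>(F u - a) * u\<bar> \<le> B"
      using B(2)[OF True] True by (simp add: abs_mult)
    ultimately show ?thesis
      using D by linarith
  qed
  then show ?thesis by blast
qed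

section \<open>The measure with mass \<Lambda>(n)/n at log n\<close>

definition log_pp :: "nat \<times> nat \<Rightarrow> real" where
  "log_pp i = real (snd i) * ln (p (fst i))"

definition wt_pp :: "nat \<times> nat \<Rightarrow> real" where
  "wt_pp i = ln (p (fst i)) / p (fst i) ^ snd i"

definition pp :: "(nat \<times> nat) set" where
  "pp = {i. snd i \<ge> 1}"

text \<open>The masses are indexed by pairs \<open>(k, j)\<close> before being pushed forward by the
  logarithm, so prime powers of equal value contribute with multiplicity.\<close>

definition \<mu> :: "real measure" where
  "\<mu> = distr (density (count_space pp) (\<lambda>i. ennreal (wt_pp i))) borel log_pp"

lemma sets_mu [measurable_cong]: "sets \<mu> = sets borel"
  by (simp add: \<mu>_def)

lemma exp_log_pp: "exp (log_pp i) = p (fst i) ^ snd i"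
  using p_pos[of "fst i"] by (simp add: log_pp_def exp_of_nat_mult)

lemma wt_pp_nonneg: "wt_pp i \<ge> 0"
  using ln_p_pos p_pos by (simp add: wt_pp_def less_imp_le)

lemma prime_pows_eq: "prime_pows p (exp u) = {i \<in> pp. log_pp i < u}"
proof -
  have "p k ^ j < exp u \<longleftrightarrow> log_pp (k, j) < u" for k j
    using exp_log_pp[of "(k, j)"] by (metis exp_less_cancel_iff fst_conv snd_conv)
  then show ?thesis
    by (auto simp: prime_pows_def pp_def)
qed

text \<open>An integrand vanishing from \<open>u\<close> on sees only finitely many prime
  powers.\<close>

lemma nn_integral_mu:
  assumes [measurable]: "f \<in> borel_measurable borel" and zero: "\<And>v. v \<ge> u \<Longrightarrow> f v = 0"
  shows "(\<integral>\<^sup>+v. f v \<partial>\<mu>) = (\<Sum>i\<in>prime_pows p (exp u). ennreal (wt_pp i) * f (log_pp i))"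
proof -
  have "(\<integral>\<^sup>+v. f v \<partial>\<mu>) = (\<integral>\<^sup>+i. ennreal (wt_pp i) * f (log_pp i) \<partial>count_space pp)"
    unfolding \<mu>_def by (simp add: nn_integral_distr nn_integral_density)
  also have "\<dots> = (\<Sum>i\<in>prime_pows p (exp u). ennreal (wt_pp i) * f (log_pp i))"
    by (rule nn_integral_count_space'[OF finite_prime_pows]) (auto simp: prime_pows_eq zero)
  finally show ?thesis .
qed

lemma mu_pos: "AE x in \<mu>. 0 < x"
proof -
  have "log_pp i > 0" if "i \<in> pp" for i
    using that ln_p_pos by (simp add: log_pp_def pp_def)
  then show ?thesis
    unfolding \<mu>_def by (subst AE_distr_iff) (auto simp: AE_density AE_count_space)
qed

text \<open>This is \<open>sum_ln_gen_int\<close> at \<open>x = exp u\<close>, divided by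
  \<open>exp u\<close>.\<close>

lemma F_conv: "(\<integral>\<^sup>+v. ennreal (F (u - v)) \<partial>\<mu>) = ennreal (G u)"
proof -
  have "(\<integral>\<^sup>+v. ennreal (F (u - v)) \<partial>\<mu>)
      = (\<Sum>i\<in>prime_pows p (exp u). ennreal (wt_pp i) * ennreal (F (u - log_pp i)))"
  proof (rule nn_integral_mu)
    show "ennreal (F (u - v)) = 0" if "v \<ge> u" for v
      using that by (simp add: F_def)
  qed measurable
  also have "\<dots> = (\<Sum>i\<in>prime_pows p (exp u). ennreal (exp (- u) * (ln (p (fst i)) * N (exp u / p (fst i) ^ snd i))))"
  proof (rule sum.cong[OF refl])
    fix i assume "i \<in> prime_pows p (exp u)"
    then have "u - log_pp i > 0"
      by (simp add: prime_pows_eq)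
    then have F: "F (u - log_pp i) = N (exp u / exp (log_pp i)) * (exp (- u) * exp (log_pp i))"
      by (simp add: F_def exp_diff exp_minus field_simps)
    have "wt_pp i * F (u - log_pp i) = exp (- u) * (ln (p (fst i)) * N (exp u / p (fst i) ^ snd i))"
      unfolding wt_pp_def F exp_log_pp[symmetric] by simp
    then show "ennreal (wt_pp i) * ennreal (F (u - log_pp i))
        = ennreal (exp (- u) * (ln (p (fst i)) * N (exp u / p (fst i) ^ snd i)))"
      using wt_pp_nonneg by (simp add: ennreal_mult'[symmetric])
  qed
  also have "\<dots> = ennreal (\<Sum>i\<in>prime_pows p (exp u). exp (- u) * (ln (p (fst i)) * N (exp u / p (fst i) ^ snd i)))"
    using ln_p_pos N_nonneg by (intro sum_ennreal) (simp add: less_imp_le)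
  also have "\<dots> = ennreal (G u)"
    by (simp add: G_def sum_ln_gen_int sum_distrib_left case_prod_unfold)
  finally show ?thesis .
qed

text \<open>The substitution x = e^z turns dx/x into dz and the given integrand into
  \<open>\<bar>F z - a\<bar>\<close>.\<close>

lemma F_integrable: "(\<integral>\<^sup>+z. ennreal \<bar>F z - a * indicator {0<..} z\<bar> \<partial>lborel) < \<infinity>"
proof -
  let ?f = "\<lambda>x. \<bar>(N x - a * x) / x\<bar> / x"
  let ?h = "\<lambda>z. \<bar>exp z\<bar> * ?f (exp z)"
  have img: "exp ` {0::real..} = {1..}"
  proof (intro equalityI subsetI)
    fix x :: real assume "x \<in> {1..}"
    then show "x \<in> exp ` {0..}"
      by (intro image_eqI[of _ _ "ln x"]) auto
  qed auto
  \<comment> \<open>Nonnegativity upgrades gauge integrability to absolute integrability, as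
    required for the change of variables and the passage to Lebesgue integrals.\<close>
  have "?f absolutely_integrable_on {1..}"
    by (rule nonnegative_absolutely_integrable_1[OF error_integrable]) auto
  then have "?f absolutely_integrable_on (exp ` {0..}) \<and> integral (exp ` {0..}) ?f = integral {1..} ?f"
    by (simp add: img)
  then have "?h absolutely_integrable_on {0..}"
    by (subst (asm) has_absolute_integral_change_of_variables_1'[symmetric])
       (auto intro!: derivative_eq_intros simp: inj_on_def)
  then have "integrable lebesgue (\<lambda>z. indicator {0..} z *\<^sub>R ?h z)"
    by (simp add: set_integrable_def)
  then have "(\<integral>\<^sup>+z. ennreal (norm (indicator {0..} z *\<^sub>R ?h z)) \<partial>lebesgue) < \<infinity>"
    by (simp only: integrable_iff_bounded)
  then have "(\<integral>\<^sup>+z. ennreal (norm (indicator {0..} z *\<^sub>R ?h z)) \<partial>lborel) < \<infinity>"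
    by (simp only: nn_integral_completion)
  moreover have "(\<integral>\<^sup>+z. ennreal \<bar>F z - a * indicator {0<..} z\<bar> \<partial>lborel)
      \<le> (\<integral>\<^sup>+z. ennreal (norm (indicator {0..} z *\<^sub>R ?h z)) \<partial>lborel)"
  proof (intro nn_integral_mono ennreal_leI)
    fix z :: real
    show "\<bar>F z - a * indicator {0<..} z\<bar> \<le> norm (indicator {0..} z *\<^sub>R ?h z)"
    proof (cases "z > 0")
      case True
      have "F z - a = (N (exp z) - a * exp z) / exp z"
        using True by (simp add: F_def exp_minus field_simps)
      then show ?thesis
        using True by simp
    qed (simp add: F_def)
  qed
  ultimately show ?thesis
    by (rule order_le_less_trans[rotated])
qed

text \<open>The weight \<open>exp (x - t)\<close> at x = log n restores \<Lambda>(n) from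
  \<Lambda>(n)/n, up to the common factor \<open>exp (- t)\<close>.\<close>

lemma psi_eq:
  "(\<integral>\<^sup>+x. ennreal (exp (x - t)) * indicator {..<t} x \<partial>\<mu>) = ennreal (beurling_psi p (exp t) / exp t)"
proof -
  have "(\<integral>\<^sup>+x. ennreal (exp (x - t)) * indicator {..<t} x \<partial>\<mu>)
      = (\<Sum>i\<in>prime_pows p (exp t). ennreal (wt_pp i) * (ennreal (exp (log_pp i - t)) * indicator {..<t} (log_pp i)))"
    by (rule nn_integral_mu) auto
  also have "\<dots> = (\<Sum>i\<in>prime_pows p (exp t). ennreal (ln (p (fst i)) / exp t))"
  proof (rule sum.cong[OF refl])
    fix i assume "i \<in> prime_pows p (exp t)"
    then have "log_pp i < t"
      by (simp add: prime_pows_eq)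
    moreover have "wt_pp i * exp (log_pp i - t) = ln (p (fst i)) / exp t"
      unfolding wt_pp_def exp_log_pp[symmetric] by (simp add: exp_diff)
    ultimately show "ennreal (wt_pp i) * (ennreal (exp (log_pp i - t)) * indicator {..<t} (log_pp i))
        = ennreal (ln (p (fst i)) / exp t)"
      using wt_pp_nonneg by (simp add: ennreal_mult'[symmetric])
  qed
  also have "\<dots> = ennreal (\<Sum>i\<in>prime_pows p (exp t). ln (p (fst i)) / exp t)"
    using ln_p_pos by (intro sum_ennreal) (simp add: less_imp_le)
  also have "\<dots> = ennreal (beurling_psi p (exp t) / exp t)"
    by (simp add: beurling_psi_def prime_pows_def sum_divide_distrib case_prod_unfold)
  finally show ?thesis .
qed

lemma chebyshev_bounds:
  "\<exists>c>0. \<exists>C. \<forall>\<^sub>F x in at_top. c \<le> beurling_psi p x / x \<and> beurling_psi p x / x \<le> C"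
proof -
  obtain m where m: "m > 0" "\<And>z. z > 0 \<Longrightarrow> m \<le> F z"
    using F_lower by blast
  obtain B where B: "\<And>u. \<bar>G u - a * max 0 u\<bar> \<le> B"
    using G_approx by blast
  interpret renewal_measure \<mu> a B m F G
    by unfold_locales
       (use a_pos m B sets_mu mu_pos F_integrable F_conv in \<open>auto simp: F_def[of z for z]\<close>)
  obtain c C t0 where c: "c > 0" and S: "\<And>t. t \<ge> t0 \<Longrightarrow> ennreal c \<le> exp_conv t \<and> exp_conv t \<le> ennreal C"
    using exp_conv_bounds by blast
  \<comment> \<open>\<open>ennreal C\<close> is 0 for negative \<open>C\<close>, hence
    \<open>max 0 C\<close> in the real bound.\<close>
  have "c \<le> beurling_psi p x / x \<and> beurling_psi p x / x \<le> max 0 C" if "x \<ge> exp t0" for x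
  proof -
    have "x > 0"
      using that exp_gt_zero[of t0] by linarith
    then have "exp_conv (ln x) = ennreal (beurling_psi p x / x)"
      unfolding exp_conv_def psi_eq by simp
    moreover have "ln x \<ge> t0"
      using that \<open>x > 0\<close> by (simp add: ln_ge_iff)
    moreover have "beurling_psi p x \<ge> 0"
      unfolding beurling_psi_def using ln_p_pos by (intro sum_nonneg) (auto simp: less_imp_le)
    ultimately show ?thesis
      using S[of "ln x"] \<open>x > 0\<close> c by (auto simp: ennreal_le_iff2 max_def)
  qed
  then show ?thesis
    using c unfolding eventually_at_top_linorder by blast
qed

end

theorem theorem1:
  fixes p :: "nat \<Rightarrow> real" and a :: real
  assumes "beurling_primes p"
    and "a > 0"
    and "(\<lambda>x. \<bar>(beurling_N p x - a * x) / x\<bar> / x) integrable_on {1..}"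
    and "(\<lambda>x. beurling_N p x - a * x) \<in> o[at_top](\<lambda>x. x / ln x)"
  shows "0 < Liminf at_top (\<lambda>x. ereal (beurling_psi p x / x)) \<and>
         Limsup at_top (\<lambda>x. ereal (beurling_psi p x / x)) < \<infinity>"
proof -
  interpret beurling_approx p a
    by unfold_locales (fact assms)+
  obtain c C where c: "c > 0"
    and ev: "\<forall>\<^sub>F x in at_top. c \<le> beurling_psi p x / x \<and> beurling_psi p x / x \<le> C"
    using chebyshev_bounds by blast
  have "ereal c \<le> Liminf at_top (\<lambda>x. ereal (beurling_psi p x / x))"
    by (rule Liminf_bounded) (use ev in eventually_elim, simp)
  moreover have "Limsup at_top (\<lambda>x. ereal (beurling_psi p x / x)) \<le> ereal C"
    by (rule Limsup_bounded) (use ev in eventually_elim, simp)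
  ultimately show ?thesis
    using c by (auto intro: order_less_le_trans[of 0 "ereal c"] order_le_less_trans[of _ "ereal C"])
qed

end
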